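(* Let $w\in A(\mathbb{D})$ be such that $\inf_{z\in\overline{\mathbb{D}}}|w(z)|>0$. Let $p\in[1,\infty]$ and define $\omega:=w|_{\mathbb{D}}$. Then the multiplication operator $$M_\omega:\varphi\in H^p(\mathbb{D})\mapsto\varphi\cdot\omega\in H^p(\mathbb{D})$$ is an invertible operator, and the following assertions are equivalent: \begin{itemize} \item[(a)] $M_\omega$ has the shadowing property; \item[(b)] $|w(z)|\neq1$ for all $z\in\overline{\mathbb{D}}$. \end{itemize}
   Context: $\mathbb{D}=\{z\in\mathbb{C}:|z|<1\}$. $A(\mathbb{D})$ is the space of continuous functions $\varphi:\overline{\mathbb{D}}\to\mathbb{C}$ whose restriction to $\mathbb{D}$ is holomorphic. $H^p(\mathbb{D})$ is the Hardy space: for $1\le p<\infty$, the Banach space of holomorphic $\varphi:\mathbb{D}\to\mathbb{C}$ with $\|\varphi\|_p=\left(\sup_{0<r<1}\frac{1}{2\pi}\int_0^{2\pi}|\varphi(re^{i\theta})|^p\,d\theta\right)^{1/p}<\infty$; for $p=\infty$, the Banach space of bounded holomorphic $\varphi:\mathbb{D}\to\mathbb{C}$ with $\|\varphi\|_\infty=\sup_{z\in\mathbb{D}}|\varphi(z)|$. An (invertible) operator on a Banach space is a continuous (invertible) linear self-map. Shadowing: an invertible operator $T$ on a Banach space $X$ has the shadowing property if for every $\varepsilon>0$ there is $\delta>0$ such that for every sequence $(x_j)_{j\in\mathbb{Z}}$ in $X$ with $\|T(x_j)-x_{j+1}\|\le\delta$ for all $j\in\mathbb{Z}$ there is $x\in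 X$ with $\|x_j-T^j(x)\|<\varepsilon$ for all $j\in\mathbb{Z}$. *)

theory Defs
  imports "HOL-Analysis.Analysis" "HOL-Library.Function_Algebras"
begin

section \<open>Complex Banach spaces with an explicit carrier\<close>

text \<open>
  The Hardy spaces depend on the exponent, so they are rendered as subspaces of one ambient
  vector space, each with its own norm; the type-class hierarchy of normed spaces does not apply.
\<close>

locale complex_normed_space = vector_space scale
  for scale :: "complex \<Rightarrow> 'a::ab_group_add \<Rightarrow> 'a" +
  fixes X :: "'a set" and N :: "'a \<Rightarrow> real"
  assumes subspace_carrier: "subspace X"
    and norm_nonneg: "x \<in> X \<Longrightarrow> 0 \<le> N x"
    and norm_eq_0: "x \<in> X \<Longrightarrow> N x = 0 \<longleftrightarrow> x = 0"
    and norm_scale: "x \<in> X \<Longrightarrow> N (scale c x) = cmod c * N x"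
    and norm_triangle: "x \<in> X \<Longrightarrow> y \<in> X \<Longrightarrow> N (x + y) \<le> N x + N y"

text \<open>
  The locale \<^locale>\<open>Metric_space\<close> requires nonnegativity and symmetry on the whole type,
  hence the value 0 off the carrier.
\<close>

definition norm_dist :: "'a::ab_group_add set \<Rightarrow> ('a \<Rightarrow> real) \<Rightarrow> 'a \<Rightarrow> 'a \<Rightarrow> real" where
  "norm_dist X N x y = (if x \<in> X \<and> y \<in> X then N (x - y) else 0)"

sublocale complex_normed_space \<subseteq> Metric_space X "norm_dist X N"
proof
  show "0 \<le> norm_dist X N x y" for x y
    using norm_nonneg subspace_diff[OF subspace_carrier] by (simp add: norm_dist_def)
  show "norm_dist X N x y = norm_dist X N y x" for x y
  proof (cases "x \<in> X \<and> y \<in> X")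
    case True
    have "N (scale (- 1) (x - y)) = N (x - y)"
      using True norm_scale[of "x - y" "- 1"] subspace_diff[OF subspace_carrier] by simp
    moreover have "scale (- 1) (x - y) = y - x"
      by (simp only: scale_minus_left scale_one minus_diff_eq)
    ultimately show ?thesis
      using True by (simp add: norm_dist_def)
  qed (auto simp: norm_dist_def)
  show "norm_dist X N x y = 0 \<longleftrightarrow> x = y" if "x \<in> X" "y \<in> X" for x y
    using that norm_eq_0 subspace_diff[OF subspace_carrier] by (simp add: norm_dist_def)
  show "norm_dist X N x z \<le> norm_dist X N x y + norm_dist X N y z"
    if "x \<in> X" "y \<in> X" "z \<in> X" for x y z
    using that norm_triangle[of "x - y" "y - z"] subspace_diff[OF subspace_carrier]
    by (simp add: norm_dist_def)
qed

locale complex_banach_space = complex_normed_space +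
  assumes complete: "mcomplete"

locale banach_operator = complex_banach_space scale X N
  for scale :: "complex \<Rightarrow> 'a::ab_group_add \<Rightarrow> 'a" and X :: "'a set" and N :: "'a \<Rightarrow> real" +
  fixes T :: "'a \<Rightarrow> 'a"
  assumes maps_carrier: "x \<in> X \<Longrightarrow> T x \<in> X"
    and additive: "x \<in> X \<Longrightarrow> y \<in> X \<Longrightarrow> T (x + y) = T x + T y"
    and homogeneous: "x \<in> X \<Longrightarrow> T (scale c x) = scale c (T x)"
    and continuous: "continuous_map mtopology mtopology T"

locale invertible_banach_operator = banach_operator +
  assumes invertible: "\<exists>S. banach_operator scale X N S \<and> (\<forall>x\<in>X. S (T x) = x \<and> T (S x) = x)"


section \<open>Shadowing\<close>

definition int_iterate :: "'a set \<Rightarrow> ('a \<Rightarrow> 'a) \<Rightarrow> int \<Rightarrow> 'a \<Rightarrow> 'a" where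
  "int_iterate X T j = (if 0 \<le> j then T ^^ nat j else inv_into X T ^^ nat (- j))"

definition shadowing_property ::
    "'a::ab_group_add set \<Rightarrow> ('a \<Rightarrow> real) \<Rightarrow> ('a \<Rightarrow> 'a) \<Rightarrow> bool" where
  "shadowing_property X N T \<longleftrightarrow>
     (\<forall>\<epsilon>>0. \<exists>\<delta>>0. \<forall>x :: int \<Rightarrow> 'a.
        (\<forall>j. x j \<in> X) \<and> (\<forall>j. N (T (x j) - x (j + 1)) \<le> \<delta>) \<longrightarrow>
        (\<exists>y\<in>X. \<forall>j. N (x j - int_iterate X T j y) < \<epsilon>))"


section \<open>Function spaces on the unit disc\<close>

text \<open>Only the values on the closed unit disc are relevant.\<close>

definition disc_algebra :: "(complex \<Rightarrow> complex) set" where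
  "disc_algebra = {f. continuous_on (cball 0 1) f \<and> f holomorphic_on ball 0 1}"

definition fun_scale :: "complex \<Rightarrow> (complex \<Rightarrow> complex) \<Rightarrow> complex \<Rightarrow> complex" where
  "fun_scale c f = (\<lambda>z. c * f z)"

definition circle_mean :: "real \<Rightarrow> (complex \<Rightarrow> complex) \<Rightarrow> real \<Rightarrow> real" where
  "circle_mean q f r =
     1 / (2 * pi) * integral {0..2 * pi} (\<lambda>\<theta>. cmod (f (of_real r * cis \<theta>)) powr q)"

text \<open>
  A function on the disc is represented by its extension by 0, so that equality in the Hardy
  space is equality of functions on the disc.
\<close>

definition hardy :: "ereal \<Rightarrow> (complex \<Rightarrow> complex) set" where
  "hardy p = {f. f holomorphic_on ball 0 1 \<and> (\<forall>z. z \<notin> ball 0 1 \<longrightarrow> f z = 0) \<and>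
     (if p = \<infinity> then bounded (f ` ball 0 1)
      else bdd_above (circle_mean (real_of_ereal p) f ` {0<..<1}))}"

definition hardy_norm :: "ereal \<Rightarrow> (complex \<Rightarrow> complex) \<Rightarrow> real" where
  "hardy_norm p f =
     (if p = \<infinity> then (SUP z\<in>ball 0 1. cmod (f z))
      else (SUP r\<in>{0<..<1}. circle_mean (real_of_ereal p) f r) powr (1 / real_of_ereal p))"

definition mult_op :: "(complex \<Rightarrow> complex) \<Rightarrow> (complex \<Rightarrow> complex) \<Rightarrow> complex \<Rightarrow> complex" where
  "mult_op \<omega> \<phi> = (\<lambda>z. \<phi> z * \<omega> z)"

end

theory Submission
  imports Defs "HOL-Complex_Analysis.Complex_Analysis"
begin

text \<open>
  Everything depends on the closure of \<open>\<omega> ` ball 0 1\<close>, which equals \<open>w ` cball 0 1\<close>, and the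
  argument works for every holomorphic symbol \<open>u\<close> on the disc that is bounded and bounded away
  from \<open>0\<close>: multiplication by \<open>u\<close> has the shadowing property iff the closure \<open>A\<close> of the range of
  \<open>u\<close> misses the unit circle (\<open>hardy_mult_op_shadowing_iff\<close>).

  If \<open>A\<close> misses the circle, then, being connected and compact, it lies in a disc of radius \<open>c < 1\<close>
  or outside a disc of radius \<open>1 / c\<close>. So either the operator or its inverse contracts the Hardy
  norm by the factor \<open>c\<close>. A contraction of a Banach space has the shadowing property: for a
  pseudo-orbit \<open>x\<close> the points \<open>(T ^^ n) (x (j - n))\<close> converge as \<open>n\<close> grows, because consecutive
  ones differ by at most \<open>c ^ n * \<delta>\<close>, and the limits form an exact orbit near \<open>x\<close>. Shadowing
  passes from an operator to its inverse by reversing time.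

  Conversely let \<open>\<lambda>\<close> be a point of \<open>A\<close> on the circle. Starting from \<open>0\<close> and adding the error
  \<open>\<lambda> ^ (n + 1) * f\<close> at time \<open>n \<ge> 0\<close> gives the pseudo-orbit \<open>\<lambda> ^ n * h n * f\<close>, where \<open>h n\<close> is the
  geometric sum of the powers \<open>(u / \<lambda>) ^ m\<close>, \<open>m < n\<close>. If \<open>\<lambda> = u z\<close> with \<open>z\<close> in the disc, the value
  of this at \<open>z\<close> grows linearly, while orbits have constant modulus at \<open>z\<close>; since point evaluation
  is continuous, nothing shadows it. Otherwise \<open>|u|\<close> stays on one side of \<open>1\<close>, say below it (else
  replace \<open>u\<close> by \<open>1 / u\<close>). The only orbit that stays bounded in the past is then \<open>0\<close>, so shadowing
  says that multiplication by \<open>h n\<close> is bounded with a constant \<open>C\<close> not depending on \<open>n\<close>. The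
  powers of a multiplier applied to the constant function \<open>1\<close> show that \<open>|h n| \<le> C\<close> on the disc,
  and by continuity the geometric sum at \<open>\<lambda>\<close> itself, which is \<open>n\<close>, is at most \<open>C\<close> for every \<open>n\<close>: a
  contradiction. This uses of the Hardy space only that it is a Banach space containing the
  constants, that point evaluations are continuous, and that a pointwise bound \<open>|g| \<le> c |f|\<close>
  implies the same bound for the norms, so all exponents are treated alike.
\<close>

section \<open>Shadowing for operators on normed spaces\<close>

definition exact_orbit :: "'a set \<Rightarrow> ('a \<Rightarrow> 'a) \<Rightarrow> (int \<Rightarrow> 'a) \<Rightarrow> bool" where
  "exact_orbit X T y \<longleftrightarrow> (\<forall>j. y j \<in> X \<and> T (y j) = y (j + 1))"

definition pseudo_orbit ::
    "'a::ab_group_add set \<Rightarrow> ('a \<Rightarrow> real) \<Rightarrow> ('a \<Rightarrow> 'a) \<Rightarrow> real \<Rightarrow> (int \<Rightarrow> 'a) \<Rightarrow> bool" where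
  "pseudo_orbit X N T \<delta> x \<longleftrightarrow> (\<forall>j. x j \<in> X \<and> N (T (x j) - x (j + 1)) \<le> \<delta>)"

lemma exact_orbit_int_iterate:
  assumes bij: "bij_betw T X X" and y: "y \<in> X"
  shows "exact_orbit X T (\<lambda>j. int_iterate X T j y)"
proof -
  have T_in: "T x \<in> X" if "x \<in> X" for x
    using bij that by (auto simp: bij_betw_def)
  have inv_in: "inv_into X T x \<in> X" and T_inv: "T (inv_into X T x) = x" if "x \<in> X" for x
    using bij that by (auto simp: bij_betw_def inv_into_into f_inv_into_f)
  have pow_in: "(T ^^ n) y \<in> X" for n
    by (induction n) (auto simp: y T_in)
  have inv_pow_in: "(inv_into X T ^^ n) y \<in> X" for n
    by (induction n) (auto simp: y inv_in)
  have "T (int_iterate X T j y) = int_iterate X T (j + 1) y" for j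
  proof (cases "0 \<le> j")
    case True
    then show ?thesis by (simp add: int_iterate_def nat_add_distrib)
  next
    case False
    then obtain n where n: "nat (- j) = Suc n" by (cases "nat (- j)") auto
    with False have j1: "j + 1 = - int n" by linarith
    have "int_iterate X T (j + 1) y = (inv_into X T ^^ n) y"
      unfolding j1 int_iterate_def by (cases n) (auto simp: nat_add_distrib)
    then show ?thesis
      using False n inv_pow_in[of n] by (simp add: int_iterate_def T_inv)
  qed
  moreover have "int_iterate X T j y \<in> X" for j
    by (simp add: int_iterate_def pow_in inv_pow_in)
  ultimately show ?thesis by (simp add: exact_orbit_def)
qed

lemma exact_orbit_eq_int_iterate:
  assumes inj: "inj_on T X" and y: "exact_orbit X T y"
  shows "y j = int_iterate X T j (y 0)"
proof -
  have y_in: "y i \<in> X" and Ty: "T (y i) = y (i + 1)" for i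
    using y by (auto simp: exact_orbit_def)
  have inv: "inv_into X T (y i) = y (i - 1)" for i
    using Ty[of "i - 1"] inj y_in by (intro inv_into_f_eq) auto
  have "y (int n) = (T ^^ n) (y 0)" for n
  proof (induction n)
    case (Suc n)
    have "y (int (Suc n)) = T (y (int n))"
      by (simp add: Ty add.commute)
    with Suc show ?case by simp
  qed simp
  moreover have "y (- int n) = (inv_into X T ^^ n) (y 0)" for n
  proof (induction n)
    case (Suc n)
    have "y (- int (Suc n)) = inv_into X T (y (- int n))"
      unfolding inv by (rule arg_cong[of _ _ y]) simp
    with Suc show ?case by simp
  qed simp
  ultimately show ?thesis
    by (cases j rule: int_cases4) (auto simp: int_iterate_def)
qed

text \<open>
  Two-sided orbits are determined by their value at time \<open>0\<close>, so shadowing can be stated with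
  orbits in place of \<open>int_iterate\<close>. In this form time can be reversed and orbits can be built as
  limits.
\<close>

lemma shadowing_property_iff_exact_orbits:
  assumes "bij_betw T X X"
  shows "shadowing_property X N T \<longleftrightarrow>
    (\<forall>\<epsilon>>0. \<exists>\<delta>>0. \<forall>x. pseudo_orbit X N T \<delta> x \<longrightarrow>
       (\<exists>y. exact_orbit X T y \<and> (\<forall>j. N (x j - y j) < \<epsilon>)))"
proof -
  have "(\<exists>y\<in>X. \<forall>j. N (x j - int_iterate X T j y) < \<epsilon>) \<longleftrightarrow>
      (\<exists>y. exact_orbit X T y \<and> (\<forall>j. N (x j - y j) < \<epsilon>))" for x :: "int \<Rightarrow> 'a" and \<epsilon>
  proof
    assume "\<exists>y\<in>X. \<forall>j. N (x j - int_iterate X T j y) < \<epsilon>"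
    then show "\<exists>y. exact_orbit X T y \<and> (\<forall>j. N (x j - y j) < \<epsilon>)"
      using exact_orbit_int_iterate[OF assms] by blast
  next
    assume "\<exists>y. exact_orbit X T y \<and> (\<forall>j. N (x j - y j) < \<epsilon>)"
    then obtain y where y: "exact_orbit X T y" "\<forall>j. N (x j - y j) < \<epsilon>" by blast
    have "y j = int_iterate X T j (y 0)" for j
      by (rule exact_orbit_eq_int_iterate[OF bij_betw_imp_inj_on[OF assms] y(1)])
    moreover have "y 0 \<in> X" using y(1) by (simp add: exact_orbit_def)
    ultimately show "\<exists>y\<in>X. \<forall>j. N (x j - int_iterate X T j y) < \<epsilon>"
      using y(2) by metis
  qed
  then show ?thesis
    unfolding shadowing_property_def pseudo_orbit_def by (simp only: all_conj_distrib)
qed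

text \<open>
  The errors of a pseudo-orbit are differences, so linearity enters the arguments on shadowing
  through differences.
\<close>

definition bounded_operator_by ::
    "'a::ab_group_add set \<Rightarrow> ('a \<Rightarrow> real) \<Rightarrow> real \<Rightarrow> ('a \<Rightarrow> 'a) \<Rightarrow> bool" where
  "bounded_operator_by X N K T \<longleftrightarrow>
     (\<forall>x\<in>X. T x \<in> X \<and> N (T x) \<le> K * N x) \<and> (\<forall>x\<in>X. \<forall>y\<in>X. T (x - y) = T x - T y)"

definition inverse_pair :: "'a set \<Rightarrow> ('a \<Rightarrow> 'a) \<Rightarrow> ('a \<Rightarrow> 'a) \<Rightarrow> bool" where
  "inverse_pair X T S \<longleftrightarrow> (\<forall>x\<in>X. T x \<in> X \<and> S x \<in> X \<and> S (T x) = x \<and> T (S x) = x)"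

lemma inverse_pair_sym: "inverse_pair X T S \<Longrightarrow> inverse_pair X S T"
  by (auto simp: inverse_pair_def)

lemma inverse_pair_bij_betw: "inverse_pair X T S \<Longrightarrow> bij_betw T X X"
  by (rule bij_betw_byWitness[where f' = S]) (auto simp: inverse_pair_def)

context complex_normed_space
begin

lemmas carrier_diff = subspace_diff[OF subspace_carrier]
lemmas carrier_zero = subspace_0[OF subspace_carrier]

lemma norm_minus_commute: "x \<in> X \<Longrightarrow> y \<in> X \<Longrightarrow> N (x - y) = N (y - x)"
  using commute[of x y] by (simp add: norm_dist_def)

lemma norm_zero: "N 0 = 0"
  using norm_eq_0 carrier_zero by blast

lemma norm_triangle_diff:
  "x \<in> X \<Longrightarrow> y \<in> X \<Longrightarrow> z \<in> X \<Longrightarrow> N (x - z) \<le> N (x - y) + N (y - z)"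
  using triangle[of x y z] by (simp add: norm_dist_def)

text \<open>
  Reversing time turns orbits of the inverse into orbits of the operator, and pseudo-orbits into
  pseudo-orbits whose errors are multiplied by at most the operator bound \<open>K\<close>: the error
  \<open>T (x (i + 1)) - x i\<close> is the image under \<open>T\<close> of \<open>x (i + 1) - S (x i)\<close>.
\<close>

lemma shadowing_property_inverse:
  assumes inv: "inverse_pair X T S" and bd: "bounded_operator_by X N K T" and K: "K > 0"
    and sh: "shadowing_property X N T"
  shows "shadowing_property X N S"
  unfolding shadowing_property_iff_exact_orbits[OF inverse_pair_bij_betw[OF inverse_pair_sym[OF inv]]]
proof (intro allI impI)
  fix \<epsilon> :: real assume "\<epsilon> > 0"
  then obtain \<delta> where \<delta>: "\<delta> > 0"
    and shad: "\<And>x. pseudo_orbit X N T \<delta> x \<Longrightarrow>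
      \<exists>y. exact_orbit X T y \<and> (\<forall>j. N (x j - y j) < \<epsilon>)"
    using sh unfolding shadowing_property_iff_exact_orbits[OF inverse_pair_bij_betw[OF inv]] by blast
  have "\<exists>y. exact_orbit X S y \<and> (\<forall>j. N (x j - y j) < \<epsilon>)"
    if x: "pseudo_orbit X N S (\<delta> / K) x" for x
  proof -
    have x_in: "x j \<in> X" and x_step: "N (S (x j) - x (j + 1)) \<le> \<delta> / K" for j
      using x by (auto simp: pseudo_orbit_def)
    have "N (T (x (- j)) - x (- (j + 1))) \<le> \<delta>" for j
    proof -
      define i where "i = - (j + 1)"
      have i: "- j = i + 1" by (simp add: i_def)
      have Si: "S (x i) \<in> X" using inv x_in by (auto simp: inverse_pair_def)
      have "N (T (x (i + 1)) - x i) = N (T (x (i + 1) - S (x i)))"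
        using bd inv x_in Si by (simp add: bounded_operator_by_def inverse_pair_def)
      also have "\<dots> \<le> K * N (x (i + 1) - S (x i))"
        using bd carrier_diff[OF x_in Si] by (simp add: bounded_operator_by_def)
      also have "\<dots> \<le> K * (\<delta> / K)"
        using x_step[of i] norm_minus_commute[OF x_in Si] K by (intro mult_left_mono) auto
      finally show ?thesis using K unfolding i i_def[symmetric] by simp
    qed
    then obtain y where y: "exact_orbit X T y" "\<And>j. N (x (- j) - y j) < \<epsilon>"
      using shad[of "\<lambda>j. x (- j)"] x_in by (auto simp: pseudo_orbit_def)
    have "S (y (- j)) = y (- (j + 1))" for j
    proof -
      have "T (y (- (j + 1))) = y (- j)" and "y (- (j + 1)) \<in> X"
        using y(1) by (simp_all add: exact_orbit_def)
      then show ?thesis using inv by (metis inverse_pair_def)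
    qed
    then have "exact_orbit X S (\<lambda>j. y (- j))"
      using y(1) by (simp add: exact_orbit_def)
    moreover have "N (x j - y (- j)) < \<epsilon>" for j
      using y(2)[of "- j"] by simp
    ultimately show ?thesis by (intro exI[of _ "\<lambda>j. y (- j)"]) auto
  qed
  then show "\<exists>\<delta>>0. \<forall>x. pseudo_orbit X N S \<delta> x \<longrightarrow>
      (\<exists>y. exact_orbit X S y \<and> (\<forall>j. N (x j - y j) < \<epsilon>))"
    using \<delta> K by (intro exI[of _ "\<delta> / K"]) auto
qed

end

context complex_banach_space
begin

text \<open>
  The tail of a geometric series makes the sequence Cauchy. The bound at \<open>n = 0\<close> measures the
  distance of a pseudo-orbit to its shadow; the factor \<open>c ^ n\<close> is needed to see that the shadow is
  an orbit.
\<close>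

lemma geometric_steps_limit:
  fixes \<sigma> :: "nat \<Rightarrow> 'a"
  assumes \<sigma>: "\<And>n. \<sigma> n \<in> X" and step: "\<And>n. N (\<sigma> (Suc n) - \<sigma> n) \<le> c ^ n * \<delta>"
    and c: "0 \<le> c" "c < 1"
  obtains y where "y \<in> X" "\<And>n. N (\<sigma> n - y) \<le> c ^ n * \<delta> / (1 - c)"
proof -
  have \<delta>: "0 \<le> \<delta>"
    using step[of 0] norm_nonneg[OF carrier_diff[OF \<sigma> \<sigma>]] by (metis mult_1 order_trans power_0)
  have dist: "N (\<sigma> (n + k) - \<sigma> n) \<le> (c ^ n - c ^ (n + k)) * \<delta> / (1 - c)" for n k
  proof (induction k)
    case 0
    then show ?case by (simp add: norm_zero)
  next
    case (Suc k)
    have "N (\<sigma> (n + Suc k) - \<sigma> n) \<le> N (\<sigma> (Suc (n + k)) - \<sigma> (n + k)) + N (\<sigma> (n + k) - \<sigma> n)"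
      using norm_triangle_diff[OF \<sigma> \<sigma> \<sigma>] by simp
    also have "\<dots> \<le> c ^ (n + k) * \<delta> + (c ^ n - c ^ (n + k)) * \<delta> / (1 - c)"
      using step Suc by (intro add_mono)
    also have "\<dots> = (c ^ n - c ^ (n + Suc k)) * \<delta> / (1 - c)"
      using c by (simp add: field_simps)
    finally show ?case .
  qed
  have tail: "N (\<sigma> m - \<sigma> n) \<le> c ^ n * \<delta> / (1 - c)" if "n \<le> m" for m n
  proof -
    have "N (\<sigma> m - \<sigma> n) \<le> (c ^ n - c ^ m) * \<delta> / (1 - c)"
      using dist[of n "m - n"] that by simp
    also have "\<dots> \<le> c ^ n * \<delta> / (1 - c)"
      using c \<delta> by (intro divide_right_mono mult_right_mono) auto
    finally show ?thesis .
  qed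
  have small: "(\<lambda>n. c ^ n * \<delta> / (1 - c)) \<longlonglongrightarrow> 0"
    using tendsto_mult_left[OF LIMSEQ_realpow_zero[OF c], of "\<delta> / (1 - c)"] by (simp add: mult.commute)
  have "MCauchy \<sigma>"
    unfolding MCauchy_def
  proof (intro conjI allI impI)
    show "range \<sigma> \<subseteq> X" using \<sigma> by auto
    fix \<epsilon> :: real assume "\<epsilon> > 0"
    then obtain M where M: "\<And>n. n \<ge> M \<Longrightarrow> c ^ n * \<delta> / (1 - c) < \<epsilon>"
      using order_tendstoD(2)[OF small] by (auto simp: eventually_sequentially)
    have "norm_dist X N (\<sigma> n) (\<sigma> n') < \<epsilon>" if "M \<le> n" "M \<le> n'" for n n'
    proof (cases "n \<le> n'")
      case True
      then show ?thesis
        using tail[OF True] M[OF that(1)] norm_minus_commute[OF \<sigma> \<sigma>, of n n'] \<sigma>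
        by (simp add: norm_dist_def)
    next
      case False
      then show ?thesis
        using tail[of n' n] M[OF that(2)] \<sigma> by (simp add: norm_dist_def)
    qed
    then show "\<exists>M. \<forall>n n'. M \<le> n \<longrightarrow> M \<le> n' \<longrightarrow> norm_dist X N (\<sigma> n) (\<sigma> n') < \<epsilon>" by blast
  qed
  then obtain y where y: "limitin mtopology \<sigma> y sequentially"
    using complete mcomplete_def by blast
  then have y_in: "y \<in> X" and lim: "(\<lambda>n. N (\<sigma> n - y)) \<longlonglongrightarrow> 0"
    using \<sigma> by (auto simp: limitin_metric_dist_null norm_dist_def)
  have "N (\<sigma> n - y) \<le> c ^ n * \<delta> / (1 - c)" for n
  proof (rule tendsto_lowerbound)
    show "(\<lambda>m. c ^ n * \<delta> / (1 - c) + N (\<sigma> m - y)) \<longlonglongrightarrow> c ^ n * \<delta> / (1 - c)"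
      using tendsto_add[OF tendsto_const lim] by simp
    have "N (\<sigma> n - y) \<le> c ^ n * \<delta> / (1 - c) + N (\<sigma> m - y)" if "m \<ge> n" for m
      using norm_triangle_diff[OF \<sigma> \<sigma> y_in, of n m] tail[OF that] norm_minus_commute[OF \<sigma> \<sigma>, of n m]
      by linarith
    then show "\<forall>\<^sub>F m in sequentially. N (\<sigma> n - y) \<le> c ^ n * \<delta> / (1 - c) + N (\<sigma> m - y)"
      by (auto simp: eventually_sequentially)
  qed simp
  with y_in that show ?thesis by blast
qed

text \<open>
  The shadow at time \<open>j\<close> is the limit of the points reached at time \<open>j\<close> by following \<open>T\<close> exactly
  from \<open>x (j - n)\<close>: starting one step earlier changes the outcome by one error, contracted \<open>n\<close>
  times. As \<open>T\<close> maps the \<open>n\<close>-th approximation at time \<open>j\<close> to the approximation of index \<open>n + 1\<close> at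
  time \<open>j + 1\<close>, the limits form an orbit.
\<close>

lemma shadowing_property_contraction:
  assumes bij: "bij_betw T X X" and bd: "bounded_operator_by X N c T" and c: "0 \<le> c" "c < 1"
  shows "shadowing_property X N T"
  unfolding shadowing_property_iff_exact_orbits[OF bij]
proof (intro allI impI)
  fix \<epsilon> :: real assume \<epsilon>: "\<epsilon> > 0"
  \<comment> \<open>errors of size \<open>\<delta>\<close> add up to a geometric series with sum \<open>\<delta> / (1 - c) = \<epsilon> / 2\<close>\<close>
  define \<delta> where "\<delta> = (1 - c) * (\<epsilon> / 2)"
  have \<delta>: "\<delta> > 0" using \<epsilon> c by (simp add: \<delta>_def)
  have T_in: "T x \<in> X" and T_le: "N (T x) \<le> c * N x" if "x \<in> X" for x
    using bd that by (auto simp: bounded_operator_by_def)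
  have T_diff: "T (x - y) = T x - T y" if "x \<in> X" "y \<in> X" for x y
    using bd that by (auto simp: bounded_operator_by_def)
  have pow_in: "(T ^^ n) x \<in> X" if "x \<in> X" for n x
    by (induction n) (auto simp: that T_in)
  have pow_dist: "N ((T ^^ n) x - (T ^^ n) y) \<le> c ^ n * N (x - y)" if "x \<in> X" "y \<in> X" for n x y
  proof (induction n)
    case (Suc n)
    have "N ((T ^^ Suc n) x - (T ^^ Suc n) y) \<le> c * N ((T ^^ n) x - (T ^^ n) y)"
      using T_le[OF carrier_diff[OF pow_in pow_in]] T_diff[OF pow_in pow_in] that by simp
    also have "\<dots> \<le> c * (c ^ n * N (x - y))"
      using Suc c by (intro mult_left_mono)
    finally show ?case by simp
  qed simp
  have "\<exists>y. exact_orbit X T y \<and> (\<forall>j. N (x j - y j) < \<epsilon>)" if x: "pseudo_orbit X N T \<delta> x" for x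
  proof -
    have x_in: "x j \<in> X" and x_step: "N (T (x j) - x (j + 1)) \<le> \<delta>" for j
      using x by (auto simp: pseudo_orbit_def)
    define \<sigma> where "\<sigma> j n = (T ^^ n) (x (j - int n))" for j n
    have \<sigma>_in: "\<sigma> j n \<in> X" for j n by (simp add: \<sigma>_def pow_in x_in)
    have \<sigma>_step: "N (\<sigma> j (Suc n) - \<sigma> j n) \<le> c ^ n * \<delta>" for j n
    proof -
      define i where "i = j - int (Suc n)"
      have i: "j - int n = i + 1" by (simp add: i_def)
      have "N (\<sigma> j (Suc n) - \<sigma> j n) = N ((T ^^ n) (T (x i)) - (T ^^ n) (x (i + 1)))"
        unfolding \<sigma>_def i i_def[symmetric] by (simp only: funpow_Suc_right o_apply)
      also have "\<dots> \<le> c ^ n * N (T (x i) - x (i + 1))"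
        by (rule pow_dist[OF T_in[OF x_in] x_in])
      also have "\<dots> \<le> c ^ n * \<delta>" using x_step c by (intro mult_left_mono) auto
      finally show ?thesis .
    qed
    have "\<exists>y\<in>X. \<forall>n. N (\<sigma> j n - y) \<le> c ^ n * \<delta> / (1 - c)" for j
      by (rule geometric_steps_limit[of "\<sigma> j" c \<delta>, OF \<sigma>_in \<sigma>_step c]) blast
    then obtain y where y_in: "y j \<in> X"
      and y: "N (\<sigma> j n - y j) \<le> c ^ n * \<delta> / (1 - c)" for j n
      by metis
    have "T (y j) = y (j + 1)" for j
    proof -
      have bound: "N (T (y j) - y (j + 1)) \<le> 2 * (c ^ Suc n * \<delta> / (1 - c))" for n
      proof -
        define e where "e = c ^ Suc n * \<delta> / (1 - c)"
        have shift: "T (\<sigma> j n) = \<sigma> (j + 1) (Suc n)" by (simp add: \<sigma>_def)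
        have "N (T (y j) - T (\<sigma> j n)) = N (T (y j - \<sigma> j n))"
          by (simp add: T_diff y_in \<sigma>_in)
        also have "\<dots> \<le> c * N (y j - \<sigma> j n)"
          by (rule T_le[OF carrier_diff[OF y_in \<sigma>_in]])
        also have "\<dots> \<le> c * (c ^ n * \<delta> / (1 - c))"
          using y[of j n] norm_minus_commute[OF y_in \<sigma>_in] c by (intro mult_left_mono) auto
        finally have "N (T (y j) - T (\<sigma> j n)) \<le> e" by (simp add: e_def)
        then show ?thesis
          using norm_triangle_diff[OF T_in[OF y_in[of j]] \<sigma>_in[of "j + 1" "Suc n"] y_in[of "j + 1"]]
            y[of "j + 1" "Suc n"] unfolding shift e_def[symmetric] by linarith
      qed
      have "(\<lambda>n. 2 * (c ^ Suc n * \<delta> / (1 - c))) \<longlonglongrightarrow> 0"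
        using tendsto_mult_left[OF LIMSEQ_Suc[OF LIMSEQ_realpow_zero[OF c]], of "2 * \<delta> / (1 - c)"]
        by (simp add: field_simps)
      then have "N (T (y j) - y (j + 1)) \<le> 0"
        by (rule tendsto_lowerbound) (use bound in auto)
      then have "T (y j) - y (j + 1) = 0"
        using norm_eq_0 norm_nonneg carrier_diff[OF T_in[OF y_in] y_in] by (metis antisym)
      then show ?thesis by simp
    qed
    moreover have "N (x j - y j) < \<epsilon>" for j
    proof -
      have "\<delta> / (1 - c) = \<epsilon> / 2" unfolding \<delta>_def using c by (intro nonzero_mult_div_cancel_left) simp
      then show ?thesis using y[of j 0] \<epsilon> by (simp add: \<sigma>_def)
    qed
    ultimately show ?thesis using y_in by (auto simp: exact_orbit_def)
  qed
  with \<delta> show "\<exists>\<delta>>0. \<forall>x. pseudo_orbit X N T \<delta> x \<longrightarrow>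
      (\<exists>y. exact_orbit X T y \<and> (\<forall>j. N (x j - y j) < \<epsilon>))" by blast
qed

lemma banach_operatorI:
  assumes bd: "bounded_operator_by X N K T"
    and add: "\<And>x y. x \<in> X \<Longrightarrow> y \<in> X \<Longrightarrow> T (x + y) = T x + T y"
    and hom: "\<And>c x. x \<in> X \<Longrightarrow> T (scale c x) = scale c (T x)"
  shows "banach_operator scale X N T"
proof unfold_locales
  show "continuous_map mtopology mtopology T"
    unfolding continuous_map_to_metric
  proof (intro ballI allI impI)
    fix x and \<epsilon> :: real assume "x \<in> topspace mtopology" "\<epsilon> > 0"
    then have x: "x \<in> X" by simp
    define U where "U = mball x (\<epsilon> / (\<bar>K\<bar> + 1))"
    have "T y \<in> mball (T x) \<epsilon>" if "y \<in> U" for y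
    proof -
      have y: "y \<in> X" and d: "N (x - y) < \<epsilon> / (\<bar>K\<bar> + 1)"
        using that x by (auto simp: U_def norm_dist_def)
      have "N (T x - T y) \<le> K * N (x - y)"
        using bd x y carrier_diff[OF x y] by (metis bounded_operator_by_def)
      also have "\<dots> \<le> (\<bar>K\<bar> + 1) * N (x - y)"
        using norm_nonneg[OF carrier_diff[OF x y]] by (intro mult_right_mono) auto
      also have "\<dots> < \<epsilon>" using d by (simp add: pos_less_divide_eq mult.commute)
      finally show ?thesis
        using bd x y by (simp add: norm_dist_def bounded_operator_by_def)
    qed
    moreover have "openin mtopology U" "x \<in> U"
      using x \<open>\<epsilon> > 0\<close> by (auto simp: U_def intro!: divide_pos_pos)
    ultimately show "\<exists>U. openin mtopology U \<and> x \<in> U \<and> (\<forall>y\<in>U. T y \<in> mball (T x) \<epsilon>)" by blast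
  qed
qed (use bd add hom in \<open>auto simp: bounded_operator_by_def\<close>)

end

section \<open>Circle means\<close>

lemma continuous_on_circle_power:
  assumes f: "continuous_on (ball 0 1) f" and r: "0 < r" "r < 1" and q: "0 < q"
  shows "continuous_on {0..2 * pi} (\<lambda>\<theta>. cmod (f (of_real r * cis \<theta>)) powr q)"
proof -
  have "continuous_on {0..2 * pi} (\<lambda>\<theta>. f (of_real r * cis \<theta>))"
    by (rule continuous_on_compose2[OF f]) (use r in \<open>auto intro!: continuous_intros simp: norm_mult\<close>)
  then show ?thesis
    using q by (intro continuous_on_powr' continuous_intros) auto
qed

lemma integrable_circle_power:
  assumes "continuous_on (ball 0 1) f" and "0 < r" "r < 1" and "0 < q"
  shows "(\<lambda>\<theta>. cmod (f (of_real r * cis \<theta>)) powr q) integrable_on {0..2 * pi}"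
  by (intro integrable_continuous_real continuous_on_circle_power assms)

text \<open>
  Every estimate of means below is a pointwise inequality of this affine form, integrated.
\<close>

lemma circle_mean_affine_bound:
  assumes h: "h integrable_on {0..2 * pi}"
    and f: "continuous_on (ball 0 1) f" and g: "continuous_on (ball 0 1) g"
    and r: "0 < r" "r < 1" and q: "0 < q"
    and le: "\<And>\<theta>. h \<theta> \<le> a * cmod (f (of_real r * cis \<theta>)) powr q + b * cmod (g (of_real r * cis \<theta>)) powr q + c"
  shows "1 / (2 * pi) * integral {0..2 * pi} h \<le> a * circle_mean q f r + b * circle_mean q g r + c"
proof -
  note int = integrable_circle_power[OF f r q] integrable_circle_power[OF g r q]
  have "integral {0..2 * pi} h \<le>
      integral {0..2 * pi} (\<lambda>\<theta>. a * cmod (f (of_real r * cis \<theta>)) powr q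
        + b * cmod (g (of_real r * cis \<theta>)) powr q + c)"
    by (intro integral_le h le integrable_add integrable_on_mult_right int) auto
  also have "\<dots> = a * integral {0..2 * pi} (\<lambda>\<theta>. cmod (f (of_real r * cis \<theta>)) powr q)
      + b * integral {0..2 * pi} (\<lambda>\<theta>. cmod (g (of_real r * cis \<theta>)) powr q)
      + Henstock_Kurzweil_Integration.content {0..2 * pi} *\<^sub>R c"
    by (intro integral_unique has_integral_add has_integral_mult_right has_integral_const_real
        integrable_integral int)
  finally show ?thesis
    by (simp add: circle_mean_def field_simps)
qed

lemma circle_mean_nonneg: "0 \<le> circle_mean q f r"
proof (cases "(\<lambda>\<theta>. cmod (f (of_real r * cis \<theta>)) powr q) integrable_on {0..2 * pi}")
  case True
  then show ?thesis
    unfolding circle_mean_def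
    by (intro mult_nonneg_nonneg Henstock_Kurzweil_Integration.integral_nonneg) auto
qed (simp add: circle_mean_def not_integrable_integral)

lemma circle_mean_le_of_norm_le:
  assumes f: "continuous_on (ball 0 1) f" and r: "0 < r" "r < 1" and q: "0 < q"
    and le: "\<And>z. cmod z = r \<Longrightarrow> cmod (f z) \<le> b"
  shows "circle_mean q f r \<le> b powr q"
  using circle_mean_affine_bound[OF integrable_circle_power[OF f r q] f f r q, of 0 0 "b powr q"]
    le r q by (simp add: circle_mean_def powr_mono2 norm_mult)

lemma circle_mean_mult_le:
  assumes f: "continuous_on (ball 0 1) f" and g: "continuous_on (ball 0 1) g"
    and r: "0 < r" "r < 1" and q: "0 < q"
    and le: "\<And>z. cmod z = r \<Longrightarrow> cmod (g z) \<le> b * cmod (f z)" and b: "0 \<le> b"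
  shows "circle_mean q g r \<le> b powr q * circle_mean q f r"
proof -
  have "cmod (g (of_real r * cis \<theta>)) powr q \<le> b powr q * cmod (f (of_real r * cis \<theta>)) powr q" for \<theta>
    using powr_mono2[OF _ _ le[of "of_real r * cis \<theta>"], of q] q r b by (simp add: norm_mult powr_mult)
  then show ?thesis
    using circle_mean_affine_bound[OF integrable_circle_power[OF g r q] f f r q, of "b powr q" 0 0]
    by (simp add: circle_mean_def)
qed

lemma powr_convex_combination:
  fixes s t :: real
  assumes q: "1 \<le> q" and st: "0 \<le> s" "0 \<le> t" and \<alpha>: "0 \<le> \<alpha>" "0 \<le> \<beta>" "\<alpha> + \<beta> = 1"
  shows "(\<alpha> * s + \<beta> * t) powr q \<le> \<alpha> * s powr q + \<beta> * t powr q"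
proof -
  have one: "(\<gamma> * u) powr q \<le> \<gamma> * u powr q" if "0 \<le> \<gamma>" "\<gamma> \<le> 1" "0 \<le> u" for \<gamma> u :: real
  proof -
    have "\<gamma> powr q \<le> \<gamma> powr 1" using that q by (intro powr_mono') auto
    then show ?thesis using that by (simp add: powr_mult mult_right_mono)
  qed
  consider "s = 0" | "t = 0" | "s > 0" "t > 0" using st by linarith
  then show ?thesis
  proof cases
    case 3
    then show ?thesis
      using powr_convex[OF q] \<alpha> by (auto simp: convex_on_def)
  qed (use one[of \<beta> t] one[of \<alpha> s] \<alpha> st in auto)
qed

text \<open>
  The graph of \<open>s powr q\<close> lies above its tangent at \<open>s = 1\<close>; integrated, this bounds a mean of
  order 1 by one of order \<open>q\<close> and stands in for Hoelder's inequality.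
\<close>

lemma le_powr_affine:
  fixes s :: real
  assumes q: "1 \<le> q" and s: "0 \<le> s"
  shows "s \<le> s powr q / q + (1 - 1 / q)"
proof (cases "s = 0")
  case False
  then show ?thesis
    using Youngs_inequality_0[of "1 / q" "1 - 1 / q" "s powr q" 1] q s by (simp add: powr_powr)
qed (use q in auto)

text \<open>
  Minkowski's inequality without norms: \<open>|u + v| / (a + b)\<close> is at most a convex combination of
  \<open>|u| / a\<close> and \<open>|v| / b\<close>, with weights proportional to \<open>a\<close> and \<open>b\<close>, so by convexity the power \<open>q\<close>
  of the left side has mean at most \<open>1\<close>.
\<close>

lemma circle_mean_add_le:
  assumes f: "continuous_on (ball 0 1) f" and g: "continuous_on (ball 0 1) g"
    and r: "0 < r" "r < 1" and q: "1 \<le> q"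
    and a: "circle_mean q f r \<le> a powr q" "0 < a" and b: "circle_mean q g r \<le> b powr q" "0 < b"
  shows "circle_mean q (\<lambda>z. f z + g z) r \<le> (a + b) powr q"
proof -
  define \<alpha> \<beta> where "\<alpha> = a / (a + b)" and "\<beta> = b / (a + b)"
  have \<alpha>\<beta>: "0 \<le> \<alpha>" "0 \<le> \<beta>" "\<alpha> + \<beta> = 1"
    using a b by (auto simp: \<alpha>_def \<beta>_def add_divide_distrib[symmetric])
  have *: "cmod (u + v) powr q \<le> (a + b) powr q * \<alpha> / a powr q * cmod u powr q
      + (a + b) powr q * \<beta> / b powr q * cmod v powr q" for u v :: complex
  proof -
    have "cmod u + cmod v = (a + b) * (\<alpha> * (cmod u / a) + \<beta> * (cmod v / b))"
      using a b by (simp add: \<alpha>_def \<beta>_def distrib_left)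
    then have "cmod (u + v) powr q \<le> ((a + b) * (\<alpha> * (cmod u / a) + \<beta> * (cmod v / b))) powr q"
      using q by (intro powr_mono2) (auto intro: order_trans[OF norm_triangle_ineq])
    also have "\<dots> = (a + b) powr q * (\<alpha> * (cmod u / a) + \<beta> * (cmod v / b)) powr q"
      by (rule powr_mult)
    also have "\<dots> \<le> (a + b) powr q * (\<alpha> * (cmod u / a) powr q + \<beta> * (cmod v / b) powr q)"
      using a b q \<alpha>\<beta> by (intro mult_left_mono powr_convex_combination) auto
    finally show ?thesis
      using a b by (simp add: powr_divide distrib_left mult.assoc)
  qed
  have "circle_mean q (\<lambda>z. f z + g z) r \<le> (a + b) powr q * \<alpha> / a powr q * circle_mean q f r
      + (a + b) powr q * \<beta> / b powr q * circle_mean q g r + 0"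
    unfolding circle_mean_def[of q "\<lambda>z. f z + g z"] using q *
    by (intro circle_mean_affine_bound f g r integrable_circle_power continuous_intros) auto
  also have "\<dots> \<le> (a + b) powr q * \<alpha> / a powr q * a powr q + (a + b) powr q * \<beta> / b powr q * b powr q + 0"
    using a b \<alpha>\<beta> by (intro add_mono mult_left_mono) auto
  also have "\<dots> = (a + b) powr q * (\<alpha> + \<beta>)"
    using a b by (simp add: distrib_left)
  finally show ?thesis using \<alpha>\<beta> by simp
qed

text \<open>
  Cauchy's formula on the circle of radius \<open>r\<close> bounds \<open>|f z|\<close> by \<open>r / (r - |z|)\<close> times the mean of
  \<open>|f|\<close>, and that mean is at most \<open>a\<close> by the tangent inequality for \<open>|f| / a\<close>.
\<close>

lemma point_evaluation_circle_mean:
  assumes f: "f holomorphic_on ball 0 1" and r: "cmod z < r" "r < 1" and q: "1 \<le> q"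
    and a: "circle_mean q f r \<le> a powr q" "0 < a"
  shows "cmod (f z) \<le> r * a / (r - cmod z)"
proof -
  have r0: "0 < r" using r norm_ge_zero[of z] by linarith
  have cont: "continuous_on (ball 0 1) f" using f by (rule holomorphic_on_imp_continuous_on)
  \<comment> \<open>the claimed bound; the estimate of the integrand below has \<open>c\<close> as its mean\<close>
  define c where "c = r * a / (r - cmod z)"
  have c: "0 \<le> c" using r0 r a by (simp add: c_def)
  let ?F = "\<lambda>t. f (0 + of_real r * cis t) / (0 + of_real r * cis t - z) * of_real r * \<i> * cis t"
  have "f holomorphic_on cball 0 r"
    using f by (rule holomorphic_on_subset) (use r in auto)
  then have "((\<lambda>u. f u / (u - z)) has_contour_integral (2 * of_real pi * \<i> * f z)) (circlepath 0 r)"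
    using r by (intro Cauchy_integral_circlepath_simple) auto
  then have F: "(?F has_integral (2 * of_real pi * \<i> * f z)) {0..2 * pi}"
    unfolding circlepath_def by (subst (asm) has_contour_integral_part_circlepath_iff) auto
  have F_le: "cmod (?F t) \<le> c / q / a powr q * cmod (f (of_real r * cis t)) powr q + c * (1 - 1 / q)" for t
  proof -
    let ?u = "of_real r * cis t"
    have "r - cmod z \<le> cmod (?u - z)"
      using norm_triangle_ineq2[of ?u z] r0 by (simp add: norm_mult)
    then have "cmod (?F t) \<le> cmod (f ?u) / (r - cmod z) * r"
      using r r0 by (auto simp: norm_mult norm_divide intro!: divide_left_mono mult_pos_pos mult_right_mono)
    also have "\<dots> = c * (cmod (f ?u) / a)"
      using a by (simp add: c_def)
    also have "\<dots> \<le> c * ((cmod (f ?u) / a) powr q / q + (1 - 1 / q))"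
      using a by (intro mult_left_mono[OF le_powr_affine[OF q] c]) auto
    also have "\<dots> = c / q / a powr q * cmod (f ?u) powr q + c * (1 - 1 / q)"
      using a by (simp add: powr_divide distrib_left)
    finally show ?thesis .
  qed
  define G where "G = (\<lambda>t. c / q / a powr q * cmod (f (of_real r * cis t)) powr q + c * (1 - 1 / q))"
  have G: "G integrable_on {0..2 * pi}"
    unfolding G_def
    by (intro integrable_add integrable_on_mult_right integrable_circle_power cont r r0) (use q in auto)
  have "2 * pi * cmod (f z) = cmod (integral {0..2 * pi} ?F)"
    using integral_unique[OF F] by (simp add: norm_mult)
  also have "\<dots> \<le> integral {0..2 * pi} G"
    by (rule integral_norm_bound_integral[OF has_integral_integrable[OF F] G])
      (use F_le in \<open>simp add: G_def\<close>)
  finally have "cmod (f z) \<le> 1 / (2 * pi) * integral {0..2 * pi} G"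
    by (simp add: field_simps)
  also have "\<dots> \<le> c / q / a powr q * circle_mean q f r + 0 * circle_mean q f r + c * (1 - 1 / q)"
    using q by (intro circle_mean_affine_bound G cont r r0) (auto simp: G_def)
  also have "\<dots> \<le> c / q / a powr q * a powr q + 0 * circle_mean q f r + c * (1 - 1 / q)"
    using a c q by (intro add_mono mult_left_mono[OF a(1)]) auto
  also have "\<dots> = c" using a by (simp add: algebra_simps)
  finally show ?thesis by (simp add: c_def)
qed

section \<open>Hardy spaces as Banach spaces\<close>

text \<open>
  For functions in the Hardy space and \<open>a \<ge> 0\<close> this says that the norm is at most \<open>a\<close>. Unlike the
  norm itself it is a conjunction of conditions on single points or circles, so it can be checked
  there, and it makes sense before membership is known.
\<close>

definition hardy_bound :: "ereal \<Rightarrow> (complex \<Rightarrow> complex) \<Rightarrow> real \<Rightarrow> bool" where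
  "hardy_bound p f a \<longleftrightarrow>
     (if p = \<infinity> then \<forall>z\<in>ball 0 1. cmod (f z) \<le> a
      else \<forall>r\<in>{0<..<1}. circle_mean (real_of_ereal p) f r \<le> a powr real_of_ereal p)"

lemma hardy_exponent: "1 \<le> p \<Longrightarrow> p \<noteq> \<infinity> \<Longrightarrow> 1 \<le> real_of_ereal p"
  by (cases p) auto

lemma hardy_bound_mono:
  assumes "1 \<le> p" "hardy_bound p f a" "0 \<le> a" "a \<le> b"
  shows "hardy_bound p f b"
proof (cases "p = \<infinity>")
  case True
  with assms show ?thesis by (force simp: hardy_bound_def)
next
  case False
  have "a powr real_of_ereal p \<le> b powr real_of_ereal p"
    using assms hardy_exponent[OF _ False] by (intro powr_mono2) auto
  with assms False show ?thesis by (force simp: hardy_bound_def)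
qed

lemma hardy_bound_mult:
  assumes p: "1 \<le> p" and f: "continuous_on (ball 0 1) f" and g: "continuous_on (ball 0 1) g"
    and le: "\<And>z. z \<in> ball 0 1 \<Longrightarrow> cmod (g z) \<le> c * cmod (f z)" and c: "0 \<le> c" and a: "0 \<le> a"
    and bd: "hardy_bound p f a"
  shows "hardy_bound p g (c * a)"
proof (cases "p = \<infinity>")
  case True
  have "cmod (g z) \<le> c * a" if "z \<in> ball 0 1" for z
    using bd that True c by (intro order_trans[OF le[OF that] mult_left_mono]) (auto simp: hardy_bound_def)
  with True show ?thesis by (simp add: hardy_bound_def)
next
  case False
  note q = hardy_exponent[OF p False]
  have "circle_mean (real_of_ereal p) g r \<le> (c * a) powr real_of_ereal p" if r: "0 < r" "r < 1" for r
  proof -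
    have "circle_mean (real_of_ereal p) g r \<le> c powr real_of_ereal p * circle_mean (real_of_ereal p) f r"
      using q by (intro circle_mean_mult_le f g r c le) (auto simp: r)
    also have "\<dots> \<le> c powr real_of_ereal p * a powr real_of_ereal p"
      using bd r False by (intro mult_left_mono) (auto simp: hardy_bound_def)
    finally show ?thesis by (simp add: powr_mult)
  qed
  with False show ?thesis by (simp add: hardy_bound_def)
qed

lemma hardy_bound_add:
  assumes p: "1 \<le> p" and f: "continuous_on (ball 0 1) f" and g: "continuous_on (ball 0 1) g"
    and a: "hardy_bound p f a" "0 < a" and b: "hardy_bound p g b" "0 < b"
  shows "hardy_bound p (\<lambda>z. f z + g z) (a + b)"
proof (cases "p = \<infinity>")
  case True
  have "cmod (f z + g z) \<le> a + b" if "z \<in> ball 0 1" for z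
    using a(1) b(1) that True unfolding hardy_bound_def
    by (intro order_trans[OF norm_triangle_ineq add_mono]) auto
  with True show ?thesis by (simp add: hardy_bound_def)
next
  case False
  with assms show ?thesis
    using circle_mean_add_le[OF f g _ _ hardy_exponent[OF p False]] by (simp add: hardy_bound_def)
qed

text \<open>
  For finite exponents the estimate on the circle of radius \<open>r\<close> is used in the limit \<open>r \<rightarrow> 1\<close>.
\<close>

lemma hardy_bound_point_evaluation:
  assumes p: "1 \<le> p" and f: "f holomorphic_on ball 0 1" and a: "hardy_bound p f a" "0 < a"
    and z: "cmod z < 1"
  shows "cmod (f z) \<le> a / (1 - cmod z)"
proof (cases "p = \<infinity>")
  case True
  then have "cmod (f z) \<le> a" using a z by (auto simp: hardy_bound_def)
  also have "\<dots> \<le> a / (1 - cmod z)"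
    using a(2) z by (simp add: pos_le_divide_eq mult_left_le)
  finally show ?thesis .
next
  case False
  have "cmod (f z) * (1 - cmod z) \<le> a"
  proof (rule tendsto_upperbound)
    show "((\<lambda>r. cmod (f z) * (r - cmod z)) \<longlongrightarrow> cmod (f z) * (1 - cmod z)) (at_left 1)"
      by (intro tendsto_intros)
    have "cmod (f z) * (r - cmod z) \<le> a" if r: "cmod z < r" "r < 1" for r
    proof -
      have "0 < r" using r norm_ge_zero[of z] by linarith
      then have "cmod (f z) \<le> r * a / (r - cmod z)"
        using a r False by (intro point_evaluation_circle_mean[OF f r hardy_exponent[OF p False]])
          (auto simp: hardy_bound_def)
      then have "cmod (f z) * (r - cmod z) \<le> r * a"
        using r by (simp add: pos_le_divide_eq)
      also have "\<dots> \<le> a" using r a by (simp add: mult_left_le_one_le \<open>0 < r\<close> less_imp_le)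
      finally show ?thesis .
    qed
    then show "\<forall>\<^sub>F r in at_left 1. cmod (f z) * (r - cmod z) \<le> a"
      using z by (auto simp: eventually_at_left_field)
  qed simp
  then show ?thesis using z by (simp add: pos_le_divide_eq)
qed

text \<open>
  On a fixed circle the limit differs from some \<open>h m\<close> by at most \<open>e\<close>, so its mean of order \<open>q\<close> is
  at most \<open>(a + e) powr q\<close> by Minkowski's inequality; then \<open>e\<close> tends to \<open>0\<close>.
\<close>

lemma hardy_bound_uniform_limit:
  assumes p: "1 \<le> p" and h: "\<And>m. continuous_on (ball 0 1) (h m)" and g: "continuous_on (ball 0 1) g"
    and lim: "\<And>s. s < 1 \<Longrightarrow> uniform_limit (cball 0 s) h g sequentially"
    and bd: "\<And>m. m \<ge> M \<Longrightarrow> hardy_bound p (h m) a" and a: "0 < a"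
  shows "hardy_bound p g a"
proof (cases "p = \<infinity>")
  case True
  have "cmod (g z) \<le> a" if z: "z \<in> ball 0 1" for z
  proof (rule tendsto_upperbound)
    show "(\<lambda>m. cmod (h m z)) \<longlonglongrightarrow> cmod (g z)"
      using z by (intro tendsto_norm tendsto_uniform_limitI[OF lim[of "cmod z"]]) auto
    show "\<forall>\<^sub>F m in sequentially. cmod (h m z) \<le> a"
      using bd z True by (auto simp: eventually_sequentially hardy_bound_def intro!: exI[of _ M])
  qed simp
  with True show ?thesis by (simp add: hardy_bound_def)
next
  case False
  define q where "q = real_of_ereal p"
  have q: "1 \<le> q" unfolding q_def by (rule hardy_exponent[OF p False])
  have "circle_mean q g r \<le> a powr q" if r: "0 < r" "r < 1" for r
  proof (rule tendsto_lowerbound)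
    show "((\<lambda>e. (a + e) powr q) \<longlongrightarrow> a powr q) (at_right 0)"
      using a by (auto intro!: tendsto_eq_intros)
    have "circle_mean q g r \<le> (a + e) powr q" if e: "0 < e" for e
    proof -
      have "\<forall>\<^sub>F m in sequentially. m \<ge> M \<and> (\<forall>z\<in>cball 0 r. dist (h m z) (g z) < e)"
        using uniform_limitD[OF lim[OF r(2)] e] eventually_ge_at_top[of M] by eventually_elim auto
      then obtain m where m: "m \<ge> M" "\<And>z. z \<in> cball 0 r \<Longrightarrow> dist (h m z) (g z) < e"
        by (auto simp: eventually_sequentially)
      have "circle_mean q (\<lambda>z. g z - h m z) r \<le> e powr q"
      proof (rule circle_mean_le_of_norm_le)
        show "cmod (g z - h m z) \<le> e" if "cmod z = r" for z
          using m(2)[of z] that by (simp add: dist_norm norm_minus_commute)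
      qed (use q r in \<open>auto intro!: continuous_intros h g\<close>)
      moreover have "circle_mean q (h m) r \<le> a powr q"
        using bd[OF m(1)] r False by (simp add: hardy_bound_def q_def)
      ultimately have "circle_mean q (\<lambda>z. h m z + (g z - h m z)) r \<le> (a + e) powr q"
        using a e by (intro circle_mean_add_le h continuous_on_diff g r q)
      then show ?thesis by simp
    qed
    then show "\<forall>\<^sub>F e in at_right 0. circle_mean q g r \<le> (a + e) powr q"
      by (auto simp: eventually_at_right_field intro!: exI[of _ 1])
  qed simp
  with False show ?thesis by (simp add: hardy_bound_def q_def)
qed

lemma hardy_bound_of_norm_le:
  assumes p: "1 \<le> p" and f: "continuous_on (ball 0 1) f"
    and le: "\<And>z. z \<in> ball 0 1 \<Longrightarrow> cmod (f z) \<le> b"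
  shows "hardy_bound p f b"
proof (cases "p = \<infinity>")
  case False
  then show ?thesis
    using circle_mean_le_of_norm_le[OF f] hardy_exponent[OF p False] le by (auto simp: hardy_bound_def)
qed (use le in \<open>simp add: hardy_bound_def\<close>)

lemma mem_hardy_iff:
  assumes p: "1 \<le> p"
  shows "f \<in> hardy p \<longleftrightarrow>
    f holomorphic_on ball 0 1 \<and> (\<forall>z. z \<notin> ball 0 1 \<longrightarrow> f z = 0) \<and> (\<exists>a>0. hardy_bound p f a)"
proof (cases "p = \<infinity>")
  case True
  then show ?thesis
    by (auto simp: hardy_def hardy_bound_def bounded_pos)
next
  case False
  define q where "q = real_of_ereal p"
  have q: "1 \<le> q" unfolding q_def by (rule hardy_exponent[OF p False])
  have "bdd_above (circle_mean q f ` {0<..<1}) \<longleftrightarrow> (\<exists>a>0. \<forall>r\<in>{0<..<1}. circle_mean q f r \<le> a powr q)"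
  proof
    assume "bdd_above (circle_mean q f ` {0<..<1})"
    then obtain B where B: "\<And>r. r \<in> {0<..<1} \<Longrightarrow> circle_mean q f r \<le> B"
      unfolding bdd_above_def by blast
    define a where "a = (\<bar>B\<bar> + 1) powr (1 / q)"
    have "a powr q = \<bar>B\<bar> + 1" using q by (simp add: a_def powr_powr)
    then have "\<forall>r\<in>{0<..<1}. circle_mean q f r \<le> a powr q" using B by fastforce
    moreover have "a > 0" by (simp add: a_def)
    ultimately show "\<exists>a>0. \<forall>r\<in>{0<..<1}. circle_mean q f r \<le> a powr q" by blast
  qed (auto simp: bdd_above_def)
  with False show ?thesis
    unfolding hardy_def hardy_bound_def q_def by simp
qed

lemma hardy_norm_nonneg: "0 \<le> hardy_norm p f" if "f \<in> hardy p"
proof (cases "p = \<infinity>")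
  case True
  then have "bdd_above (cmod ` f ` ball 0 1)"
    using that by (simp add: hardy_def bdd_above_norm)
  then have "cmod (f 0) \<le> hardy_norm p f"
    using True by (auto simp: hardy_norm_def image_image intro: cSUP_upper)
  then show ?thesis using norm_ge_zero order_trans by blast
qed (simp add: hardy_norm_def)

lemma hardy_norm_le_iff:
  assumes p: "1 \<le> p" and f: "f \<in> hardy p" and a: "0 \<le> a"
  shows "hardy_norm p f \<le> a \<longleftrightarrow> hardy_bound p f a"
proof (cases "p = \<infinity>")
  case True
  then have "bdd_above (cmod ` f ` ball 0 1)"
    using f by (simp add: hardy_def bdd_above_norm)
  then show ?thesis
    using True by (simp add: hardy_norm_def hardy_bound_def image_image cSUP_le_iff)
next
  case False
  define q where "q = real_of_ereal p"
  have q: "1 \<le> q" unfolding q_def by (rule hardy_exponent[OF p False])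
  let ?S = "SUP r\<in>{0<..<1}. circle_mean q f r"
  have bdd: "bdd_above (circle_mean q f ` {0<..<1})"
    using f False by (simp add: hardy_def q_def)
  have "circle_mean q f (1 / 2) \<le> ?S" by (rule cSUP_upper[OF _ bdd]) auto
  then have S: "0 \<le> ?S" using circle_mean_nonneg[of q f "1 / 2"] by linarith
  have "hardy_norm p f \<le> a \<longleftrightarrow> ?S powr (1 / q) \<le> (a powr q) powr (1 / q)"
    using False q a by (simp add: hardy_norm_def q_def[symmetric] powr_powr)
  also have "\<dots> \<longleftrightarrow> ?S \<le> a powr q"
    using powr_mono2[of "1 / q" ?S "a powr q"] powr_less_mono2[of "1 / q" "a powr q" ?S] S q
    by (auto simp flip: not_less)
  also have "\<dots> \<longleftrightarrow> hardy_bound p f a"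
    using False by (simp add: cSUP_le_iff[OF _ bdd] hardy_bound_def q_def[symmetric])
  finally show ?thesis .
qed

lemma hardy_holomorphic: "f \<in> hardy p \<Longrightarrow> f holomorphic_on ball 0 1"
  and hardy_outside: "f \<in> hardy p \<Longrightarrow> z \<notin> ball 0 1 \<Longrightarrow> f z = 0"
  by (auto simp: hardy_def)

lemma hardy_continuous: "f \<in> hardy p \<Longrightarrow> continuous_on (ball 0 1) f"
  by (intro holomorphic_on_imp_continuous_on hardy_holomorphic)

lemma hardy_norm_boundD:
  assumes "1 \<le> p" "f \<in> hardy p" "hardy_norm p f \<le> a" "0 \<le> a"
  shows "hardy_bound p f a"
  using assms hardy_norm_le_iff by blast

text \<open>
  Scalar multiples and products with bounded symbols are controlled by pointwise domination, for
  every exponent at once.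
\<close>

lemma hardy_dominated:
  assumes p: "1 \<le> p" and f: "f \<in> hardy p"
    and g: "g holomorphic_on ball 0 1" "\<And>z. z \<notin> ball 0 1 \<Longrightarrow> g z = 0"
    and le: "\<And>z. z \<in> ball 0 1 \<Longrightarrow> cmod (g z) \<le> c * cmod (f z)" and c: "0 \<le> c"
  shows "g \<in> hardy p" "hardy_norm p g \<le> c * hardy_norm p f"
proof -
  have "hardy_bound p f (hardy_norm p f)"
    using hardy_norm_boundD[OF p f order_refl hardy_norm_nonneg[OF f]] .
  then have bd: "hardy_bound p g (c * hardy_norm p f)"
    using hardy_norm_nonneg[OF f]
    by (intro hardy_bound_mult[OF p hardy_continuous[OF f] holomorphic_on_imp_continuous_on[OF g(1)] le c])
  have nn: "0 \<le> c * hardy_norm p f" using c hardy_norm_nonneg[OF f] by simp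
  have "hardy_bound p g (c * hardy_norm p f + 1)"
    by (rule hardy_bound_mono[OF p bd nn]) simp
  with nn show g_in: "g \<in> hardy p"
    unfolding mem_hardy_iff[OF p] using g by (metis add_nonneg_pos zero_less_one)
  show "hardy_norm p g \<le> c * hardy_norm p f"
    using hardy_norm_le_iff[OF p g_in nn] bd by simp
qed

lemma hardy_add:
  assumes p: "1 \<le> p" and f: "f \<in> hardy p" and g: "g \<in> hardy p"
  shows "f + g \<in> hardy p" "hardy_norm p (f + g) \<le> hardy_norm p f + hardy_norm p g"
proof -
  have bd: "hardy_bound p (f + g) ((hardy_norm p f + e) + (hardy_norm p g + e))" if "0 < e" for e
  proof -
    have *: "hardy_bound p h (hardy_norm p h + e)" "0 < hardy_norm p h + e" if "h \<in> hardy p" for h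
      using hardy_norm_nonneg[OF that] \<open>0 < e\<close> by (auto intro!: hardy_norm_boundD[OF p that])
    show ?thesis
      unfolding plus_fun_def by (intro hardy_bound_add p hardy_continuous[OF f] hardy_continuous[OF g] * f g)
  qed
  have pos: "0 < (hardy_norm p f + e) + (hardy_norm p g + e)" if "0 < e" for e
    using hardy_norm_nonneg[OF f] hardy_norm_nonneg[OF g] that by linarith
  have "f + g holomorphic_on ball 0 1"
    unfolding plus_fun_def by (intro holomorphic_intros hardy_holomorphic[OF f] hardy_holomorphic[OF g])
  then show fg: "f + g \<in> hardy p"
    unfolding mem_hardy_iff[OF p] using bd[of 1] pos[of 1] hardy_outside[OF f] hardy_outside[OF g]
    by (auto intro!: exI[of _ "(hardy_norm p f + 1) + (hardy_norm p g + 1)"])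
  show "hardy_norm p (f + g) \<le> hardy_norm p f + hardy_norm p g"
  proof (rule field_le_epsilon)
    fix e :: real assume "0 < e"
    then show "hardy_norm p (f + g) \<le> hardy_norm p f + hardy_norm p g + e"
      using bd[of "e / 2"] pos[of "e / 2"] hardy_norm_le_iff[OF p fg, of "hardy_norm p f + hardy_norm p g + e"]
      by (simp add: algebra_simps)
  qed
qed

lemma hardy_point_evaluation:
  assumes p: "1 \<le> p" and f: "f \<in> hardy p" and z: "cmod z < 1"
  shows "cmod (f z) \<le> hardy_norm p f / (1 - cmod z)"
proof -
  have "cmod (f z) * (1 - cmod z) \<le> hardy_norm p f"
  proof (rule field_le_epsilon)
    fix e :: real assume e: "0 < e"
    have pos: "0 < hardy_norm p f + e" using hardy_norm_nonneg[OF f] e by linarith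
    have "hardy_bound p f (hardy_norm p f + e)"
      using e pos by (intro hardy_norm_boundD[OF p f]) auto
    from hardy_bound_point_evaluation[OF p hardy_holomorphic[OF f] this pos z]
    show "cmod (f z) * (1 - cmod z) \<le> hardy_norm p f + e"
      using z by (simp add: pos_le_divide_eq)
  qed
  then show ?thesis using z by (simp add: pos_le_divide_eq)
qed

lemma zero_in_hardy: "1 \<le> p \<Longrightarrow> 0 \<in> hardy p"
  unfolding mem_hardy_iff zero_fun_def
  by (auto intro!: exI[of _ 1] hardy_bound_of_norm_le holomorphic_intros)

lemma hardy_norm_zero: "1 \<le> p \<Longrightarrow> hardy_norm p 0 = 0"
  using hardy_dominated(2)[OF _ zero_in_hardy, of p "0 :: complex \<Rightarrow> complex" 0] zero_in_hardy[of p]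
    hardy_norm_nonneg[OF zero_in_hardy, of p] hardy_holomorphic[OF zero_in_hardy, of p]
  by auto

definition disc_one :: "complex \<Rightarrow> complex" where
  "disc_one z = (if z \<in> ball 0 1 then 1 else 0)"

lemma disc_one_in_hardy: "1 \<le> p \<Longrightarrow> disc_one \<in> hardy p"
  and hardy_norm_disc_one: "1 \<le> p \<Longrightarrow> hardy_norm p disc_one \<le> 1"
proof -
  assume p: "1 \<le> p"
  have hol: "disc_one holomorphic_on ball 0 1"
    by (rule holomorphic_transform[of "\<lambda>_. 1"]) (auto simp: disc_one_def)
  have bd: "hardy_bound p disc_one 1"
    by (intro hardy_bound_of_norm_le p holomorphic_on_imp_continuous_on hol) (auto simp: disc_one_def)
  then show mem: "disc_one \<in> hardy p"
    unfolding mem_hardy_iff[OF p] using hol by (auto simp: disc_one_def intro!: exI[of _ 1])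
  show "hardy_norm p disc_one \<le> 1"
    using bd hardy_norm_le_iff[OF p mem] by simp
qed

lemma fun_scale_in_hardy:
  assumes p: "1 \<le> p" and f: "f \<in> hardy p"
  shows "fun_scale c f \<in> hardy p" "hardy_norm p (fun_scale c f) \<le> cmod c * hardy_norm p f"
proof -
  have "fun_scale c f holomorphic_on ball 0 1"
    unfolding fun_scale_def by (intro holomorphic_intros hardy_holomorphic[OF f])
  then show "fun_scale c f \<in> hardy p" "hardy_norm p (fun_scale c f) \<le> cmod c * hardy_norm p f"
    using hardy_outside[OF f]
    by (auto intro!: hardy_dominated[OF p f, of _ "cmod c"] simp: fun_scale_def norm_mult)
qed

lemma hardy_norm_fun_scale:
  assumes p: "1 \<le> p" and f: "f \<in> hardy p"
  shows "hardy_norm p (fun_scale c f) = cmod c * hardy_norm p f"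
proof (cases "c = 0")
  case True
  then have "fun_scale c f = 0" by (auto simp: fun_scale_def)
  with True p show ?thesis by (simp add: hardy_norm_zero)
next
  case False
  have "fun_scale (inverse c) (fun_scale c f) = f"
    using False by (auto simp: fun_scale_def)
  then have "hardy_norm p f \<le> cmod (inverse c) * hardy_norm p (fun_scale c f)"
    using fun_scale_in_hardy(2)[OF p fun_scale_in_hardy(1)[OF p f], of "inverse c" c] by simp
  then show ?thesis
    using fun_scale_in_hardy(2)[OF p f, of c] False by (simp add: norm_divide field_simps)
qed

lemma vector_space_fun_scale: "vector_space fun_scale"
  by unfold_locales (auto simp: fun_scale_def algebra_simps)

lemma hardy_complex_normed_space:
  assumes p: "1 \<le> p"
  shows "complex_normed_space fun_scale (hardy p) (hardy_norm p)"
proof -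
  interpret vector_space fun_scale by (rule vector_space_fun_scale)
  show ?thesis
  proof unfold_locales
    show "subspace (hardy p)"
      by (intro subspaceI zero_in_hardy hardy_add fun_scale_in_hardy p)
    fix f assume f: "f \<in> hardy p"
    show "0 \<le> hardy_norm p f" by (rule hardy_norm_nonneg[OF f])
    show "hardy_norm p f = 0 \<longleftrightarrow> f = 0"
    proof
      assume "hardy_norm p f = 0"
      then have "f z = 0" for z
        using hardy_point_evaluation[OF p f, of z] hardy_outside[OF f, of z] by (cases "cmod z < 1") auto
      then show "f = 0" by auto
    qed (simp add: hardy_norm_zero p)
    show "hardy_norm p (fun_scale c f) = cmod c * hardy_norm p f" for c
      by (rule hardy_norm_fun_scale[OF p f])
    show "hardy_norm p (f + g) \<le> hardy_norm p f + hardy_norm p g" if "g \<in> hardy p" for g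
      by (rule hardy_add(2)[OF p f that])
  qed
qed

text \<open>
  By continuity of point evaluation, uniform on smaller discs, a Cauchy sequence for the norm is
  uniformly Cauchy on compact sets, and Weierstrass's theorem makes the limit holomorphic.
\<close>

lemma hardy_uniform_limit:
  assumes p: "1 \<le> p" and f: "\<And>n. f n \<in> hardy p"
    and cauchy: "\<And>e. 0 < e \<Longrightarrow> \<exists>M. \<forall>n\<ge>M. \<forall>m\<ge>M. hardy_norm p (f n - f m) < e"
  obtains g where "g holomorphic_on ball 0 1" "\<And>z. z \<notin> ball 0 1 \<Longrightarrow> g z = 0"
    "\<And>s. s < 1 \<Longrightarrow> uniform_limit (cball 0 s) f g sequentially"
proof -
  interpret complex_normed_space fun_scale "hardy p" "hardy_norm p"
    by (rule hardy_complex_normed_space[OF p])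
  define g where "g z = (if z \<in> ball 0 1 then lim (\<lambda>n. f n z) else 0)" for z
  have ulim: "uniform_limit (cball 0 s) f g sequentially" if s: "s < 1" for s
  proof -
    have "uniformly_Cauchy_on (cball 0 s) f"
    proof (rule uniformly_Cauchy_onI)
      fix e :: real assume "0 < e"
      with s obtain M where M: "\<And>n m. n \<ge> M \<Longrightarrow> m \<ge> M \<Longrightarrow> hardy_norm p (f n - f m) < e * (1 - s)"
        using cauchy[of "e * (1 - s)"] by auto
      have "dist (f m z) (f n z) < e" if z: "z \<in> cball 0 s" and mn: "m \<ge> M" "n \<ge> M" for z m n
      proof -
        have zs: "cmod z \<le> s" using z by simp
        have "cmod ((f m - f n) z) \<le> hardy_norm p (f m - f n) / (1 - cmod z)"
          using zs s by (intro hardy_point_evaluation p carrier_diff f) auto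
        also have "\<dots> \<le> hardy_norm p (f m - f n) / (1 - s)"
          using zs s hardy_norm_nonneg[OF carrier_diff[OF f f]] by (intro divide_left_mono) auto
        also have "\<dots> < e"
          using M[OF mn] s by (simp add: pos_divide_less_eq)
        finally show ?thesis by (simp add: dist_norm)
      qed
      then show "\<exists>M. \<forall>x\<in>cball 0 s. \<forall>m\<ge>M. \<forall>n\<ge>M. dist (f m x) (f n x) < e" by blast
    qed
    then have "uniform_limit (cball 0 s) f (\<lambda>z. lim (\<lambda>n. f n z)) sequentially"
      using Cauchy_uniformly_convergent uniformly_convergent_uniform_limit_iff by blast
    then show ?thesis
      by (rule uniform_limit_cong'[THEN iffD1, rotated 2]) (use s in \<open>auto simp: g_def\<close>)
  qed
  moreover have "g holomorphic_on ball 0 1"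
  proof (rule holomorphic_uniform_sequence[OF open_ball hardy_holomorphic[OF f]])
    fix z :: complex assume z: "z \<in> ball 0 1"
    define d where "d = (1 - cmod z) / 2"
    have d: "0 < d" using z by (simp add: d_def)
    have sub: "cball z d \<subseteq> cball 0 (cmod z + d)"
    proof
      fix x assume "x \<in> cball z d"
      then show "x \<in> cball 0 (cmod z + d)"
        using norm_triangle_sub[of x z] Real_Vector_Spaces.norm_minus_commute[of z x]
        unfolding mem_cball dist_norm by simp
    qed
    have lt: "cmod z + d < 1" using z by (simp add: d_def field_simps)
    have "cball z d \<subseteq> ball 0 1" using sub lt by fastforce
    with d show "\<exists>d>0. cball z d \<subseteq> ball 0 1 \<and> uniform_limit (cball z d) f g sequentially"
      using uniform_limit_on_subset[OF ulim[OF lt] sub] by blast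
  qed
  ultimately show ?thesis using that[of g] by (auto simp: g_def)
qed

text \<open>
  For large \<open>n\<close> all differences \<open>f n - f m\<close> satisfy the bound \<open>e\<close>, and the bound survives the
  locally uniform limit in \<open>m\<close>.
\<close>

lemma hardy_complex_banach_space:
  assumes p: "1 \<le> p"
  shows "complex_banach_space fun_scale (hardy p) (hardy_norm p)"
proof -
  interpret complex_normed_space fun_scale "hardy p" "hardy_norm p"
    by (rule hardy_complex_normed_space[OF p])
  have "mcomplete"
    unfolding mcomplete_def
  proof (intro allI impI)
    fix f assume f: "MCauchy f"
    then have f_in: "f n \<in> hardy p" for n by (auto simp: MCauchy_def)
    have cauchy: "\<exists>M. \<forall>n\<ge>M. \<forall>m\<ge>M. hardy_norm p (f n - f m) < e" if "0 < e" for e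
      using f that f_in by (simp add: MCauchy_def norm_dist_def)
    obtain g where g: "g holomorphic_on ball 0 1" "\<And>z. z \<notin> ball 0 1 \<Longrightarrow> g z = 0"
      and ulim: "\<And>s. s < 1 \<Longrightarrow> uniform_limit (cball 0 s) f g sequentially"
      using hardy_uniform_limit[OF p f_in cauchy] by blast
    have close: "\<exists>M. \<forall>n\<ge>M. f n - g \<in> hardy p \<and> hardy_norm p (f n - g) \<le> e" if e: "0 < e" for e
    proof -
      obtain M where M: "\<And>n m. n \<ge> M \<Longrightarrow> m \<ge> M \<Longrightarrow> hardy_norm p (f n - f m) < e"
        using cauchy[OF e] by blast
      have "f n - g \<in> hardy p \<and> hardy_norm p (f n - g) \<le> e" if n: "n \<ge> M" for n
      proof -
        have hol: "f n - g holomorphic_on ball 0 1"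
          unfolding fun_diff_def by (intro holomorphic_on_diff hardy_holomorphic[OF f_in] g(1))
        have "hardy_bound p (f n - g) e"
        proof (rule hardy_bound_uniform_limit[OF p])
          show "continuous_on (ball 0 1) (f n - f m)" for m
            by (rule hardy_continuous[OF carrier_diff[OF f_in f_in]])
          show "continuous_on (ball 0 1) (f n - g)"
            by (rule holomorphic_on_imp_continuous_on[OF hol])
          show "uniform_limit (cball 0 s) (\<lambda>m. f n - f m) (f n - g) sequentially" if "s < 1" for s
            unfolding fun_diff_def by (intro uniform_limit_intros ulim that)
          show "hardy_bound p (f n - f m) e" if "m \<ge> M" for m
            using M[OF n that] e by (intro hardy_norm_boundD p carrier_diff f_in) auto
        qed (rule e)
        moreover from this have fg: "f n - g \<in> hardy p"
          unfolding mem_hardy_iff[OF p] using hol e hardy_outside[OF f_in] g(2) by auto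
        ultimately show ?thesis
          using hardy_norm_le_iff[OF p fg] e by simp
      qed
      then show ?thesis by blast
    qed
    obtain n where "f n - g \<in> hardy p" using close[of 1] by auto
    then have "f n - (f n - g) \<in> hardy p" by (rule carrier_diff[OF f_in])
    moreover have "f n - (f n - g) = g" by (simp add: fun_eq_iff)
    ultimately have g_in: "g \<in> hardy p" by simp
    have "limitin mtopology f g sequentially"
      unfolding limit_metric_sequentially
    proof (intro conjI allI impI g_in)
      fix e :: real assume "0 < e"
      then obtain M where "\<And>n. n \<ge> M \<Longrightarrow> hardy_norm p (f n - g) \<le> e / 2"
        using close[of "e / 2"] by auto
      then have "\<forall>n\<ge>M. f n \<in> hardy p \<and> norm_dist (hardy p) (hardy_norm p) (f n) g < e"
        using f_in g_in \<open>0 < e\<close> by (fastforce simp: norm_dist_def)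
      then show "\<exists>M. \<forall>n\<ge>M. f n \<in> hardy p \<and> norm_dist (hardy p) (hardy_norm p) (f n) g < e" by blast
    qed
    then show "\<exists>g. limitin mtopology f g sequentially" by blast
  qed
  then show ?thesis by unfold_locales
qed

section \<open>Multiplication by bounded symbols\<close>

lemma cmod_bound_nonneg: "0 \<le> K" if "\<And>z. z \<in> ball 0 1 \<Longrightarrow> cmod (u z) \<le> K" for u :: "complex \<Rightarrow> complex"
  using that[of 0] norm_ge_zero[of "u 0"] by (simp del: norm_ge_zero)

lemma mult_op_hardy:
  assumes p: "1 \<le> p" and u: "u holomorphic_on ball 0 1"
    and K: "\<And>z. z \<in> ball 0 1 \<Longrightarrow> cmod (u z) \<le> K" and f: "f \<in> hardy p"
  shows "mult_op u f \<in> hardy p" "hardy_norm p (mult_op u f) \<le> K * hardy_norm p f"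
proof -
  have "mult_op u f holomorphic_on ball 0 1"
    unfolding mult_op_def by (intro holomorphic_on_mult hardy_holomorphic[OF f] u)
  moreover have "mult_op u f z = 0" if "z \<notin> ball 0 1" for z
    using hardy_outside[OF f that] by (simp add: mult_op_def)
  moreover have "cmod (mult_op u f z) \<le> K * cmod (f z)" if "z \<in> ball 0 1" for z
    using K[OF that] by (simp add: mult_op_def norm_mult mult.commute[of K] mult_left_mono)
  ultimately show "mult_op u f \<in> hardy p" "hardy_norm p (mult_op u f) \<le> K * hardy_norm p f"
    using cmod_bound_nonneg[of u, OF K] by (auto intro!: hardy_dominated[OF p f, of _ K])
qed

lemma bounded_operator_by_mult_op:
  assumes p: "1 \<le> p" and u: "u holomorphic_on ball 0 1"
    and K: "\<And>z. z \<in> ball 0 1 \<Longrightarrow> cmod (u z) \<le> K"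
  shows "bounded_operator_by (hardy p) (hardy_norm p) K (mult_op u)"
  using mult_op_hardy[OF p u K] by (auto simp: bounded_operator_by_def mult_op_def algebra_simps)

lemma holomorphic_inverse_symbol:
  assumes u: "u holomorphic_on ball 0 1" and m: "0 < m" "\<And>z. z \<in> ball 0 1 \<Longrightarrow> m \<le> cmod (u z)"
  shows "(\<lambda>z. inverse (u z)) holomorphic_on ball 0 1"
    "\<And>z. z \<in> ball 0 1 \<Longrightarrow> cmod (inverse (u z)) \<le> inverse m"
proof -
  have "u z \<noteq> 0" if "z \<in> ball 0 1" for z using m(2)[OF that] m(1) by auto
  then show "(\<lambda>z. inverse (u z)) holomorphic_on ball 0 1" by (intro holomorphic_on_inverse u)
  show "cmod (inverse (u z)) \<le> inverse m" if "z \<in> ball 0 1" for z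
    using m(2)[OF that] m(1) by (simp add: norm_inverse le_imp_inverse_le)
qed

lemma inverse_pair_mult_op:
  assumes p: "1 \<le> p" and u: "u holomorphic_on ball 0 1"
    and m: "0 < m" "\<And>z. z \<in> ball 0 1 \<Longrightarrow> m \<le> cmod (u z)"
    and K: "\<And>z. z \<in> ball 0 1 \<Longrightarrow> cmod (u z) \<le> K"
  shows "inverse_pair (hardy p) (mult_op u) (mult_op (\<lambda>z. inverse (u z)))"
proof -
  have "mult_op (\<lambda>z. inverse (u z)) (mult_op u f) = f"
    "mult_op u (mult_op (\<lambda>z. inverse (u z)) f) = f" if f: "f \<in> hardy p" for f
  proof -
    have "f z * u z * inverse (u z) = f z" for z
    proof (cases "z \<in> ball 0 1")
      case True
      then have "u z \<noteq> 0" using m by fastforce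
      then show ?thesis by simp
    qed (simp add: hardy_outside[OF f])
    then show "mult_op (\<lambda>z. inverse (u z)) (mult_op u f) = f"
      "mult_op u (mult_op (\<lambda>z. inverse (u z)) f) = f"
      by (auto simp: mult_op_def fun_eq_iff mult.assoc mult.commute[of "inverse _"])
  qed
  then show ?thesis
    using mult_op_hardy(1)[OF p u K] mult_op_hardy(1)[OF p holomorphic_inverse_symbol[OF u m]]
    by (simp add: inverse_pair_def)
qed

lemma banach_operator_mult_op:
  assumes p: "1 \<le> p" and u: "u holomorphic_on ball 0 1"
    and K: "\<And>z. z \<in> ball 0 1 \<Longrightarrow> cmod (u z) \<le> K"
  shows "banach_operator fun_scale (hardy p) (hardy_norm p) (mult_op u)"
proof -
  interpret complex_banach_space fun_scale "hardy p" "hardy_norm p"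
    by (rule hardy_complex_banach_space[OF p])
  show ?thesis
    by (rule banach_operatorI[OF bounded_operator_by_mult_op[OF p u K]])
      (auto simp: mult_op_def fun_scale_def algebra_simps)
qed

lemma invertible_banach_operator_mult_op:
  assumes p: "1 \<le> p" and u: "u holomorphic_on ball 0 1"
    and m: "0 < m" "\<And>z. z \<in> ball 0 1 \<Longrightarrow> m \<le> cmod (u z)"
    and K: "\<And>z. z \<in> ball 0 1 \<Longrightarrow> cmod (u z) \<le> K"
  shows "invertible_banach_operator fun_scale (hardy p) (hardy_norm p) (mult_op u)"
proof -
  interpret banach_operator fun_scale "hardy p" "hardy_norm p" "mult_op u"
    by (rule banach_operator_mult_op[OF p u K])
  show ?thesis
  proof
    show "\<exists>S. banach_operator fun_scale (hardy p) (hardy_norm p) S \<and>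
        (\<forall>x\<in>hardy p. S (mult_op u x) = x \<and> mult_op u (S x) = x)"
      using inverse_pair_mult_op[OF p u m K]
        banach_operator_mult_op[OF p holomorphic_inverse_symbol[OF u m]]
      by (intro exI[of _ "mult_op (\<lambda>z. inverse (u z))"]) (auto simp: inverse_pair_def)
  qed
qed

section \<open>Resonant pseudo-orbits\<close>

text \<open>
  For \<open>l\<close> of modulus 1 this is the symbol of the \<open>n\<close>-th partial sum of the Neumann series that
  would invert \<open>1 - u / l\<close>; if \<open>l\<close> is a limit of values of \<open>u\<close>, then it takes values close to \<open>n\<close>.
\<close>

definition geometric_symbol :: "(complex \<Rightarrow> complex) \<Rightarrow> complex \<Rightarrow> nat \<Rightarrow> complex \<Rightarrow> complex" where
  "geometric_symbol u l n z = (\<Sum>m<n. (u z / l) ^ m)"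

text \<open>
  At times \<open>j \<le> 0\<close> the exponent \<open>nat j\<close> is \<open>0\<close> and the geometric sum is empty, so the sequence is
  \<open>0\<close> there, and a shadowing orbit has to stay bounded in the past.
\<close>

definition resonant_orbit ::
    "(complex \<Rightarrow> complex) \<Rightarrow> complex \<Rightarrow> (complex \<Rightarrow> complex) \<Rightarrow> int \<Rightarrow> complex \<Rightarrow> complex" where
  "resonant_orbit u l f j = fun_scale (l ^ nat j) (mult_op (geometric_symbol u l (nat j)) f)"

lemma geometric_symbol_Suc:
  "geometric_symbol u l (Suc n) z = 1 + u z / l * geometric_symbol u l n z"
  unfolding geometric_symbol_def
  by (simp add: sum.lessThan_Suc_shift sum_distrib_left del: sum.lessThan_Suc)

lemma geometric_symbol_hardy:
  assumes p: "1 \<le> p" and u: "u holomorphic_on ball 0 1"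
    and K: "\<And>z. z \<in> ball 0 1 \<Longrightarrow> cmod (u z) \<le> K" and l: "cmod l = 1" and f: "f \<in> hardy p"
  shows "mult_op (geometric_symbol u l n) f \<in> hardy p"
proof (rule mult_op_hardy(1)[OF p _ _ f])
  show "geometric_symbol u l n holomorphic_on ball 0 1"
    unfolding geometric_symbol_def using l by (intro holomorphic_intros u) auto
  show "cmod (geometric_symbol u l n z) \<le> (\<Sum>m<n. K ^ m)" if "z \<in> ball 0 1" for z
    unfolding geometric_symbol_def using K[OF that] l
    by (intro order_trans[OF norm_sum] sum_mono) (simp add: norm_power norm_divide power_mono)
qed

text \<open>
  Since \<open>h (n + 1) = 1 + (u / l) * h n\<close> for the geometric sums \<open>h\<close>, the error at time \<open>n \<ge> 0\<close> is
  \<open>- (l ^ (n + 1)) * f\<close>, which has the norm of \<open>f\<close>.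
\<close>

lemma resonant_orbit_pseudo_orbit:
  assumes p: "1 \<le> p" and u: "u holomorphic_on ball 0 1"
    and K: "\<And>z. z \<in> ball 0 1 \<Longrightarrow> cmod (u z) \<le> K" and l: "cmod l = 1" and f: "f \<in> hardy p"
  shows "pseudo_orbit (hardy p) (hardy_norm p) (mult_op u) (hardy_norm p f) (resonant_orbit u l f)"
proof -
  have "hardy_norm p (mult_op u (resonant_orbit u l f j) - resonant_orbit u l f (j + 1)) \<le> hardy_norm p f"
    for j
  proof (cases "0 \<le> j")
    case True
    have l0: "l \<noteq> 0" using l by auto
    have n: "nat (j + 1) = Suc (nat j)" using True by simp
    have "mult_op u (resonant_orbit u l f j) - resonant_orbit u l f (j + 1)
        = fun_scale (- (l ^ Suc (nat j))) f"
      using l0 unfolding resonant_orbit_def n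
      by (simp add: fun_eq_iff fun_scale_def mult_op_def geometric_symbol_Suc field_simps)
    then show ?thesis by (simp add: hardy_norm_fun_scale[OF p f] l norm_power norm_mult)
  next
    case False
    then have "mult_op u (resonant_orbit u l f j) - resonant_orbit u l f (j + 1) = 0"
      by (auto simp: resonant_orbit_def fun_eq_iff fun_scale_def mult_op_def geometric_symbol_def)
    then show ?thesis using hardy_norm_zero[OF p] hardy_norm_nonneg[OF f] by simp
  qed
  then show ?thesis
    unfolding pseudo_orbit_def
    by (auto simp: resonant_orbit_def intro!: fun_scale_in_hardy p geometric_symbol_hardy u K l f)
qed

text \<open>
  With \<open>j = - int n\<close> this also expresses the value at time \<open>0\<close> through the past.
\<close>

lemma exact_orbit_mult_op_forward:
  assumes "exact_orbit X (mult_op u) y"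
  shows "y (j + int n) z = y j z * u z ^ n"
proof (induction n)
  case (Suc n)
  have "y (j + int (Suc n)) = mult_op u (y (j + int n))"
    using assms by (simp add: exact_orbit_def ac_simps)
  with Suc show ?case by (simp add: mult_op_def)
qed simp

text \<open>
  The tolerance 1 is arbitrary: by homogeneity only its ratio to \<open>\<delta>\<close> matters.
\<close>

lemma shadowing_resonant_orbit:
  assumes p: "1 \<le> p" and u: "u holomorphic_on ball 0 1"
    and m: "0 < m" "\<And>z. z \<in> ball 0 1 \<Longrightarrow> m \<le> cmod (u z)"
    and K: "\<And>z. z \<in> ball 0 1 \<Longrightarrow> cmod (u z) \<le> K"
    and sh: "shadowing_property (hardy p) (hardy_norm p) (mult_op u)"
  obtains \<delta> where "0 < \<delta>"
    "\<And>l f. cmod l = 1 \<Longrightarrow> f \<in> hardy p \<Longrightarrow> hardy_norm p f \<le> \<delta> \<Longrightarrow>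
      \<exists>y. exact_orbit (hardy p) (mult_op u) y \<and> (\<forall>j. hardy_norm p (resonant_orbit u l f j - y j) < 1)"
proof -
  have "bij_betw (mult_op u) (hardy p) (hardy p)"
    by (rule inverse_pair_bij_betw[OF inverse_pair_mult_op[OF p u m K]])
  from sh[unfolded shadowing_property_iff_exact_orbits[OF this], rule_format, of 1]
  obtain \<delta> where \<delta>: "0 < \<delta>" and shad: "\<And>x. pseudo_orbit (hardy p) (hardy_norm p) (mult_op u) \<delta> x \<Longrightarrow>
      \<exists>y. exact_orbit (hardy p) (mult_op u) y \<and> (\<forall>j. hardy_norm p (x j - y j) < 1)"
    by auto
  show ?thesis
  proof (rule that[OF \<delta>])
    fix l f assume "cmod l = 1" "f \<in> hardy p" "hardy_norm p f \<le> \<delta>"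
    then have "pseudo_orbit (hardy p) (hardy_norm p) (mult_op u) \<delta> (resonant_orbit u l f)"
      using resonant_orbit_pseudo_orbit[OF p u K] unfolding pseudo_orbit_def by (meson order_trans)
    then show "\<exists>y. exact_orbit (hardy p) (mult_op u) y \<and>
        (\<forall>j. hardy_norm p (resonant_orbit u l f j - y j) < 1)"
      by (rule shad)
  qed
qed

text \<open>
  Take \<open>l = u z\<close> and a constant \<open>f = \<delta>\<close>. After dividing by \<open>l ^ n\<close>, at \<open>z\<close> the pseudo-orbit is
  \<open>n * \<delta>\<close> and the orbit is the fixed number \<open>y 0 z\<close>, but continuity of evaluation at \<open>z\<close> keeps
  their difference bounded.
\<close>

lemma shadowing_imp_no_unimodular_value:
  assumes p: "1 \<le> p" and u: "u holomorphic_on ball 0 1"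
    and m: "0 < m" "\<And>z. z \<in> ball 0 1 \<Longrightarrow> m \<le> cmod (u z)"
    and K: "\<And>z. z \<in> ball 0 1 \<Longrightarrow> cmod (u z) \<le> K"
    and sh: "shadowing_property (hardy p) (hardy_norm p) (mult_op u)"
    and z: "z \<in> ball 0 1"
  shows "cmod (u z) \<noteq> 1"
proof
  assume l: "cmod (u z) = 1"
  interpret complex_normed_space fun_scale "hardy p" "hardy_norm p"
    by (rule hardy_complex_normed_space[OF p])
  obtain \<delta> where \<delta>: "0 < \<delta>" and shad: "\<And>l f. cmod l = 1 \<Longrightarrow> f \<in> hardy p \<Longrightarrow> hardy_norm p f \<le> \<delta> \<Longrightarrow>
      \<exists>y. exact_orbit (hardy p) (mult_op u) y \<and> (\<forall>j. hardy_norm p (resonant_orbit u l f j - y j) < 1)"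
    using shadowing_resonant_orbit[OF p u m K sh] by blast
  define f where "f = fun_scale (of_real \<delta>) disc_one"
  have f: "f \<in> hardy p" unfolding f_def by (intro fun_scale_in_hardy disc_one_in_hardy p)
  have "hardy_norm p f \<le> \<delta>"
    unfolding f_def using \<delta> hardy_norm_fun_scale[OF p disc_one_in_hardy[OF p]] hardy_norm_disc_one[OF p]
    by (simp add: mult_left_le)
  then obtain y where y: "exact_orbit (hardy p) (mult_op u) y"
    and close: "\<And>j. hardy_norm p (resonant_orbit u (u z) f j - y j) < 1"
    using shad[OF l f] by blast
  have x_in: "resonant_orbit u (u z) f j \<in> hardy p" for j
    using resonant_orbit_pseudo_orbit[OF p u K l f] by (simp add: pseudo_orbit_def)
  have y_in: "y j \<in> hardy p" for j using y by (simp add: exact_orbit_def)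
  have bound: "real n * \<delta> \<le> 1 / (1 - cmod z) + cmod (y 0 z)" for n
  proof -
    have l0: "u z \<noteq> 0" using l by auto
    have "resonant_orbit u (u z) f (int n) z - y (int n) z = u z ^ n * (of_nat n * of_real \<delta> - y 0 z)"
      using exact_orbit_mult_op_forward[OF y, of 0 n z] l0 z
      by (simp add: resonant_orbit_def fun_scale_def mult_op_def geometric_symbol_def f_def disc_one_def
          algebra_simps)
    then have "cmod (of_nat n * of_real \<delta> - y 0 z) = cmod ((resonant_orbit u (u z) f (int n) - y (int n)) z)"
      by (simp add: norm_mult norm_power l)
    also have "\<dots> \<le> hardy_norm p (resonant_orbit u (u z) f (int n) - y (int n)) / (1 - cmod z)"
      using z by (intro hardy_point_evaluation p carrier_diff x_in y_in) auto
    also have "\<dots> \<le> 1 / (1 - cmod z)"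
      using z close[of "int n"] by (intro divide_right_mono) auto
    finally show ?thesis
      using norm_triangle_ineq2[of "of_nat n * of_real \<delta>" "y 0 z"] \<delta> by (simp add: norm_mult)
  qed
  obtain n where "1 / (1 - cmod z) + cmod (y 0 z) < real n * \<delta>"
    using reals_Archimedean3[OF \<delta>] by blast
  with bound[of n] show False by simp
qed

text \<open>
  At negative times the pseudo-orbit is \<open>0\<close>, so the shadowing orbit stays bounded in the past; as
  \<open>y 0 z = y (- k) z * u z ^ k\<close> and \<open>|u z| < 1\<close>, it vanishes. Hence the pseudo-orbit itself is
  bounded by the tolerance, for every \<open>f\<close> of norm at most \<open>\<delta>\<close>; the operator bound \<open>1 / \<delta>\<close> follows
  by scaling.
\<close>

lemma shadowing_imp_geometric_symbols_bounded:
  assumes p: "1 \<le> p" and u: "u holomorphic_on ball 0 1"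
    and m: "0 < m" "\<And>z. z \<in> ball 0 1 \<Longrightarrow> m \<le> cmod (u z)"
    and less: "\<And>z. z \<in> ball 0 1 \<Longrightarrow> cmod (u z) < 1"
    and sh: "shadowing_property (hardy p) (hardy_norm p) (mult_op u)"
  obtains C where "0 < C" "\<And>l n f. cmod l = 1 \<Longrightarrow> f \<in> hardy p \<Longrightarrow>
    hardy_norm p (mult_op (geometric_symbol u l n) f) \<le> C * hardy_norm p f"
proof -
  interpret complex_normed_space fun_scale "hardy p" "hardy_norm p"
    by (rule hardy_complex_normed_space[OF p])
  have K: "\<And>z. z \<in> ball 0 1 \<Longrightarrow> cmod (u z) \<le> 1" using less by (simp add: less_imp_le)
  obtain \<delta> where \<delta>: "0 < \<delta>" and shad: "\<And>l f. cmod l = 1 \<Longrightarrow> f \<in> hardy p \<Longrightarrow> hardy_norm p f \<le> \<delta> \<Longrightarrow>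
      \<exists>y. exact_orbit (hardy p) (mult_op u) y \<and> (\<forall>j. hardy_norm p (resonant_orbit u l f j - y j) < 1)"
    using shadowing_resonant_orbit[OF p u m K sh] by blast
  have small: "hardy_norm p (mult_op (geometric_symbol u l n) f) \<le> 1"
    if l: "cmod l = 1" and f: "f \<in> hardy p" and f_le: "hardy_norm p f \<le> \<delta>" for l n f
  proof -
    obtain y where y: "exact_orbit (hardy p) (mult_op u) y"
      and close: "\<And>j. hardy_norm p (resonant_orbit u l f j - y j) < 1"
      using shad[OF l f f_le] by blast
    have y_in: "y j \<in> hardy p" for j using y by (simp add: exact_orbit_def)
    have y0: "y 0 z = 0" if z: "z \<in> ball 0 1" for z
    proof -
      have "cmod (y 0 z) \<le> 1 / (1 - cmod z) * cmod (u z) ^ k" for k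
      proof -
        have "resonant_orbit u l f (- int k) = 0"
          by (auto simp: resonant_orbit_def fun_eq_iff fun_scale_def mult_op_def geometric_symbol_def)
        then have "hardy_norm p (y (- int k)) < 1"
          using close[of "- int k"] norm_minus_commute[OF carrier_zero y_in[of "- int k"]] by simp
        then have "hardy_norm p (y (- int k)) / (1 - cmod z) \<le> 1 / (1 - cmod z)"
          using z by (intro divide_right_mono) auto
        then have "cmod (y (- int k) z) \<le> 1 / (1 - cmod z)"
          using hardy_point_evaluation[OF p y_in, of z "- int k"] z by auto
        moreover have "cmod (y 0 z) = cmod (y (- int k) z) * cmod (u z) ^ k"
          using exact_orbit_mult_op_forward[OF y, of "- int k" k z] by (simp add: norm_mult norm_power)
        ultimately show ?thesis by (metis mult_right_mono zero_le_power norm_ge_zero)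
      qed
      moreover have "(\<lambda>k. 1 / (1 - cmod z) * cmod (u z) ^ k) \<longlonglongrightarrow> 0"
        using tendsto_mult_left[OF LIMSEQ_realpow_zero[OF norm_ge_zero less[OF z]], of "1 / (1 - cmod z)"]
        by simp
      ultimately have "cmod (y 0 z) \<le> 0"
        by (intro tendsto_lowerbound[where F = sequentially]) auto
      then show ?thesis by simp
    qed
    have "y (int n) z = 0" for z
      using exact_orbit_mult_op_forward[OF y, of 0 n z] y0[of z] hardy_outside[OF y_in, of z 0]
      by (cases "z \<in> ball 0 1") auto
    then have "y (int n) = 0" by auto
    then have "hardy_norm p (resonant_orbit u l f (int n)) < 1"
      using close[of "int n"] by simp
    then show ?thesis
      using hardy_norm_fun_scale[OF p geometric_symbol_hardy[OF p u K l f], of "l ^ n" n]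
      by (simp add: resonant_orbit_def norm_power l)
  qed
  show ?thesis
  proof (rule that[of "1 / \<delta>"])
    fix l n f assume l: "cmod l = 1" and f: "f \<in> hardy p"
    let ?G = "mult_op (geometric_symbol u l n)"
    have G: "?G f \<in> hardy p" by (rule geometric_symbol_hardy[OF p u K l f])
    show "hardy_norm p (?G f) \<le> 1 / \<delta> * hardy_norm p f"
    proof (cases "f = 0")
      case True
      then have "?G f = 0" by (auto simp: mult_op_def)
      then show ?thesis using True hardy_norm_zero[OF p] by simp
    next
      case False
      define c where "c = \<delta> / hardy_norm p f"
      have c: "0 < c" and cf: "c * hardy_norm p f = \<delta>"
        using False norm_eq_0[OF f] hardy_norm_nonneg[OF f] \<delta> by (auto simp: c_def)
      have "hardy_norm p (fun_scale c f) \<le> \<delta>"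
        using c cf by (simp add: hardy_norm_fun_scale[OF p f])
      then have "hardy_norm p (?G (fun_scale c f)) \<le> 1"
        by (intro small l fun_scale_in_hardy p f)
      also have "?G (fun_scale c f) = fun_scale c (?G f)"
        by (auto simp: mult_op_def fun_scale_def)
      finally have "c * hardy_norm p (?G f) \<le> 1"
        using c by (simp add: hardy_norm_fun_scale[OF p G])
      then have "c * \<delta> * hardy_norm p (?G f) \<le> c * hardy_norm p f"
        using \<delta> cf by (simp add: mult.commute mult.left_commute)
      then show ?thesis using c \<delta> by (simp add: field_simps)
    qed
  qed (use \<delta> in auto)
qed

text \<open>
  The iterates on the constant function 1 give \<open>|g z| ^ k \<le> C ^ k / (1 - |z|)\<close>, and the factor
  \<open>1 / (1 - |z|)\<close> disappears when \<open>k\<close>-th roots are taken. This removes the dependence of the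
  evaluation estimate on \<open>z\<close>, which is what allows \<open>z\<close> to approach the boundary.
\<close>

lemma hardy_multiplier_norm_le:
  assumes p: "1 \<le> p" and C: "0 < C"
    and g: "\<And>f. f \<in> hardy p \<Longrightarrow> mult_op g f \<in> hardy p"
      "\<And>f. f \<in> hardy p \<Longrightarrow> hardy_norm p (mult_op g f) \<le> C * hardy_norm p f"
    and z: "z \<in> ball 0 1"
  shows "cmod (g z) \<le> C"
proof (rule ccontr)
  assume "\<not> cmod (g z) \<le> C"
  then have gt: "1 < cmod (g z) / C" using C by (simp add: pos_less_divide_eq)
  let ?f = "\<lambda>k. (mult_op g ^^ k) disc_one"
  have f: "?f k \<in> hardy p \<and> hardy_norm p (?f k) \<le> C ^ k" for k
  proof (induction k)
    case 0
    then show ?case by (simp add: disc_one_in_hardy hardy_norm_disc_one p)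
  next
    case (Suc k)
    then have "hardy_norm p (?f (Suc k)) \<le> C * hardy_norm p (?f k)" using g(2) by simp
    also have "\<dots> \<le> C * C ^ k" using Suc C by (intro mult_left_mono) auto
    finally show ?case using Suc g(1) by simp
  qed
  have fz: "?f k z = g z ^ k" for k
    using z by (induction k) (auto simp: disc_one_def mult_op_def)
  obtain k where k: "1 / (1 - cmod z) < (cmod (g z) / C) ^ k"
    using real_arch_pow[OF gt] by blast
  have "cmod (g z) ^ k \<le> hardy_norm p (?f k) / (1 - cmod z)"
    using hardy_point_evaluation[OF p, of "?f k" z] f[of k] z by (simp add: fz norm_power)
  also have "\<dots> \<le> C ^ k / (1 - cmod z)"
    using f[of k] z by (intro divide_right_mono) auto
  finally have "(cmod (g z) / C) ^ k \<le> 1 / (1 - cmod z)"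
    using C by (simp add: power_divide pos_divide_le_eq)
  with k show False by simp
qed

text \<open>
  The geometric sum is a polynomial in the value \<open>t = u z\<close>, bounded by \<open>C\<close> on the range of \<open>u\<close> and
  therefore on its closure; at \<open>t = l\<close> it equals \<open>n\<close>.
\<close>

lemma shadowing_contractive_symbol_closure:
  assumes p: "1 \<le> p" and u: "u holomorphic_on ball 0 1"
    and m: "0 < m" "\<And>z. z \<in> ball 0 1 \<Longrightarrow> m \<le> cmod (u z)"
    and less: "\<And>z. z \<in> ball 0 1 \<Longrightarrow> cmod (u z) < 1"
    and sh: "shadowing_property (hardy p) (hardy_norm p) (mult_op u)"
    and l: "l \<in> closure (u ` ball 0 1)"
  shows "cmod l \<noteq> 1"
proof
  assume l1: "cmod l = 1"
  have K: "\<And>z. z \<in> ball 0 1 \<Longrightarrow> cmod (u z) \<le> 1" using less by (simp add: less_imp_le)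
  obtain C where C: "0 < C" and G: "\<And>l n f. cmod l = 1 \<Longrightarrow> f \<in> hardy p \<Longrightarrow>
      hardy_norm p (mult_op (geometric_symbol u l n) f) \<le> C * hardy_norm p f"
    using shadowing_imp_geometric_symbols_bounded[OF p u m less sh] by blast
  have l0: "l \<noteq> 0" using l1 by auto
  have "real n \<le> C" for n
  proof -
    have "cmod (\<Sum>k<n. (t / l) ^ k) \<le> C" if "t \<in> u ` ball 0 1" for t
      using that hardy_multiplier_norm_le[OF p C geometric_symbol_hardy[OF p u K l1] G[OF l1]]
      by (auto simp: geometric_symbol_def)
    then have "cmod (\<Sum>k<n. (l / l) ^ k) \<le> C"
      using l0 by (intro continuous_on_closure_norm_le[OF _ _ l, of "\<lambda>t. \<Sum>k<n. (t / l) ^ k"])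
        (auto intro!: continuous_intros)
    then show ?thesis using l0 by simp
  qed
  then show False using reals_Archimedean2[of C] by (meson not_less)
qed

section \<open>The shadowing criterion\<close>

lemma connected_avoiding_unit_circle:
  fixes S :: "complex set"
  assumes "connected S" "\<And>s. s \<in> S \<Longrightarrow> cmod s \<noteq> 1"
  shows "(\<forall>s\<in>S. cmod s < 1) \<or> (\<forall>s\<in>S. 1 < cmod s)"
proof (rule ccontr)
  assume "\<not> ?thesis"
  then obtain s t where st: "s \<in> S" "t \<in> S" "cmod t \<le> 1" "1 \<le> cmod s" by force
  have "connected (cmod ` S)"
    by (intro connected_continuous_image assms continuous_intros)
  then have "1 \<in> cmod ` S"
    by (rule connectedD_interval[of _ "cmod t" "cmod s"]) (use st in auto)
  then show False using assms(2) by auto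
qed

text \<open>
  Both directions split according to the side of the circle on which the range of \<open>u\<close> lies, and
  the outer case is reduced to the inner one by passing to the inverse symbol and the inverse
  operator.
\<close>

theorem hardy_mult_op_shadowing_iff:
  assumes p: "1 \<le> p" and u: "u holomorphic_on ball 0 1"
    and m: "0 < m" "\<And>z. z \<in> ball 0 1 \<Longrightarrow> m \<le> cmod (u z)"
    and K: "\<And>z. z \<in> ball 0 1 \<Longrightarrow> cmod (u z) \<le> K"
  shows "shadowing_property (hardy p) (hardy_norm p) (mult_op u) \<longleftrightarrow>
    (\<forall>l\<in>closure (u ` ball 0 1). cmod l \<noteq> 1)"
proof -
  interpret complex_banach_space fun_scale "hardy p" "hardy_norm p"
    by (rule hardy_complex_banach_space[OF p])
  define v where "v = (\<lambda>z. inverse (u z))"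
  have v: "v holomorphic_on ball 0 1" and v_le: "\<And>z. z \<in> ball 0 1 \<Longrightarrow> cmod (v z) \<le> inverse m"
    using holomorphic_inverse_symbol[OF u m] by (simp_all add: v_def)
  have inv: "inverse_pair (hardy p) (mult_op u) (mult_op v)"
    unfolding v_def by (rule inverse_pair_mult_op[OF p u m K])
  have u0: "u z \<noteq> 0" if "z \<in> ball 0 1" for z using m(2)[OF that] m(1) by auto
  have K0: "0 < K" using K[of 0] u0[of 0] by (auto intro: less_le_trans[of _ "cmod (u 0)"])
  have vK: "inverse K \<le> cmod (v z)" if "z \<in> ball 0 1" for z
    using K[OF that] u0[OF that] by (simp add: v_def norm_inverse le_imp_inverse_le)
  have conn: "connected (u ` ball 0 1)"
    by (intro connected_continuous_image holomorphic_on_imp_continuous_on u) simp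
  let ?A = "closure (u ` ball 0 1)"
  have m_A: "m \<le> cmod l" if "l \<in> ?A" for l
    by (rule continuous_ge_on_closure[OF _ that]) (auto intro!: continuous_intros m(2))
  show ?thesis
  proof
    assume sh: "shadowing_property (hardy p) (hardy_norm p) (mult_op u)"
    have "cmod l \<noteq> 1" if l: "l \<in> ?A" for l
    proof -
      have "cmod s \<noteq> 1" if "s \<in> u ` ball 0 1" for s
        using that shadowing_imp_no_unimodular_value[OF p u m K sh] by auto
      from connected_avoiding_unit_circle[OF conn this]
      consider "\<forall>z\<in>ball 0 1. cmod (u z) < 1" | "\<forall>z\<in>ball 0 1. 1 < cmod (u z)" by auto
      then show ?thesis
      proof cases
        case 1
        then show ?thesis using shadowing_contractive_symbol_closure[OF p u m _ sh l] by blast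
      next
        case 2
        then have less: "cmod (v z) < 1" if "z \<in> ball 0 1" for z
          using that by (simp add: v_def norm_inverse inverse_less_1_iff)
        have shv: "shadowing_property (hardy p) (hardy_norm p) (mult_op v)"
          by (rule shadowing_property_inverse[OF inv bounded_operator_by_mult_op[OF p u K] K0 sh])
        have "inverse ` ?A \<subseteq> closure (v ` ball 0 1)"
        proof (rule image_closure_subset)
          show "continuous_on ?A inverse"
            using m_A m(1) by (intro continuous_intros) force
          show "inverse ` u ` ball 0 1 \<subseteq> closure (v ` ball 0 1)"
            using closure_subset[of "v ` ball 0 1"] by (simp add: v_def image_image)
        qed simp
        then have "inverse l \<in> closure (v ` ball 0 1)" using l by auto
        then have "cmod (inverse l) \<noteq> 1"
          using K0 by (intro shadowing_contractive_symbol_closure[OF p v _ vK less shv]) auto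
        then show ?thesis by (simp add: norm_inverse)
      qed
    qed
    then show "\<forall>l\<in>?A. cmod l \<noteq> 1" by blast
  next
    assume ne: "\<forall>l\<in>?A. cmod l \<noteq> 1"
    have compact: "compact ?A"
      unfolding compact_closure bounded_iff using K by blast
    have A: "u z \<in> ?A" if "z \<in> ball 0 1" for z
      by (intro subsetD[OF closure_subset] imageI that)
    have ne_A: "?A \<noteq> {}" using A[of 0] by force
    from connected_avoiding_unit_circle[OF connected_imp_connected_closure[OF conn]] ne
    consider "\<forall>l\<in>?A. cmod l < 1" | "\<forall>l\<in>?A. 1 < cmod l" by blast
    then show "shadowing_property (hardy p) (hardy_norm p) (mult_op u)"
    proof cases
      case 1
      obtain l where l: "l \<in> ?A" "\<forall>s\<in>?A. cmod s \<le> cmod l"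
        using continuous_attains_sup[OF compact ne_A continuous_on_norm_id] by (elim bexE) (rule that)
      have "bounded_operator_by (hardy p) (hardy_norm p) (cmod l) (mult_op u)"
        by (rule bounded_operator_by_mult_op[OF p u bspec[OF l(2) A]])
      then show ?thesis
        by (rule shadowing_property_contraction[OF inverse_pair_bij_betw[OF inv] _ norm_ge_zero bspec[OF 1 l(1)]])
    next
      case 2
      obtain l where l: "l \<in> ?A" "\<forall>s\<in>?A. cmod l \<le> cmod s"
        using continuous_attains_inf[OF compact ne_A continuous_on_norm_id] by (elim bexE) (rule that)
      have l1: "1 < cmod l" by (rule bspec[OF 2 l(1)])
      have "cmod (v z) \<le> inverse (cmod l)" if "z \<in> ball 0 1" for z
        using l(2) A[OF that] l1 by (auto simp: v_def norm_inverse intro!: le_imp_inverse_le)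
      then have "bounded_operator_by (hardy p) (hardy_norm p) (inverse (cmod l)) (mult_op v)"
        by (intro bounded_operator_by_mult_op p v)
      then have "shadowing_property (hardy p) (hardy_norm p) (mult_op v)"
        using l1 by (intro shadowing_property_contraction[OF inverse_pair_bij_betw[OF inverse_pair_sym[OF inv]]])
          (auto simp: inverse_less_1_iff)
      then show ?thesis
        using shadowing_property_inverse[OF inverse_pair_sym[OF inv] bounded_operator_by_mult_op[OF p v v_le]] m(1)
        by simp
    qed
  qed
qed

text \<open>
  This is where continuity of the symbol up to the boundary enters: the limit values of \<open>w\<close> on the
  open disc are its values on the closed disc.
\<close>

lemma closure_image_ball:
  assumes "continuous_on (cball 0 1) (w :: complex \<Rightarrow> complex)"
  shows "closure (w ` ball 0 1) = w ` cball 0 1"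
proof
  have "closed (w ` cball 0 1)"
    by (intro compact_imp_closed compact_continuous_image assms compact_cball)
  then show "closure (w ` ball 0 1) \<subseteq> w ` cball 0 1"
    by (intro closure_minimal) auto
  have "w ` closure (ball 0 1) \<subseteq> closure (w ` ball 0 1)"
    using assms by (intro image_closure_subset closure_subset) auto
  then show "w ` cball 0 1 \<subseteq> closure (w ` ball 0 1)" by simp
qed

theorem corollary25:
  fixes w \<omega> :: "complex \<Rightarrow> complex" and p :: ereal
  assumes "w \<in> disc_algebra"
    and "(INF z\<in>cball 0 1. cmod (w z)) > 0"
    and "1 \<le> p"
    and "\<omega> = restrict w (ball 0 1)"
  shows "invertible_banach_operator fun_scale (hardy p) (hardy_norm p) (mult_op \<omega>)
    \<and> (shadowing_property (hardy p) (hardy_norm p) (mult_op \<omega>)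
         \<longleftrightarrow> (\<forall>z\<in>cball 0 1. cmod (w z) \<noteq> 1))"
proof -
  define m where "m = (INF z\<in>cball 0 1. cmod (w z))"
  have w: "continuous_on (cball 0 1) w" "w holomorphic_on ball 0 1"
    using assms(1) by (auto simp: disc_algebra_def)
  have \<omega>_eq: "\<omega> z = w z" if "z \<in> ball 0 1" for z using that assms(4) by simp
  have \<omega>: "\<omega> holomorphic_on ball 0 1"
    by (rule holomorphic_transform[OF w(2)]) (simp add: \<omega>_eq)
  have "bdd_below ((\<lambda>z. cmod (w z)) ` cball 0 1)" by (rule bdd_belowI[of _ 0]) auto
  then have m_le: "m \<le> cmod (\<omega> z)" if "z \<in> ball 0 1" for z
    using that unfolding m_def \<omega>_eq[OF that] by (intro cINF_lower) auto
  have "bounded (w ` cball 0 1)"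
    by (intro compact_imp_bounded compact_continuous_image w compact_cball)
  then obtain K where "\<forall>y\<in>w ` cball 0 1. cmod y \<le> K"
    unfolding bounded_iff by blast
  then have K: "cmod (\<omega> z) \<le> K" if "z \<in> ball 0 1" for z
    using that by (simp add: \<omega>_eq)
  have "\<omega> ` ball 0 1 = w ` ball 0 1" by (intro image_cong) (simp_all add: \<omega>_eq)
  then have "closure (\<omega> ` ball 0 1) = w ` cball 0 1"
    using closure_image_ball[OF w(1)] by simp
  moreover have "0 < m" using assms(2) by (simp add: m_def)
  ultimately show ?thesis
    using invertible_banach_operator_mult_op[OF assms(3) \<omega> _ m_le K]
      hardy_mult_op_shadowing_iff[OF assms(3) \<omega> _ m_le K] by simp
qed

end
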